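(* Given fixed integers $d \geq 1$ and $p\geq 2$, let \[ q(z) = \sum_{k=0}^d (-1)^k \binom{d}{k} z^{p^k}, \] and let \[ \mathcal{G}_{d,p} = \lim_{m \to \infty} \frac{ C_{d,p} \big( (m+1)(p-1)+1 \big) }{ C_{d,p} \big( m(p-1)+1 \big) } \] be the growth rate of $C_{d,p}(n)$. Then \[ \mathcal{G}_{d,p} = \frac{1}{(q(s))^{p-1}}, \] where $s$ is the smallest positive real number where $q'(s) =0$.
   Context: Fix integers $d\ge 1$ and $p\ge 2$. For an open rectangle $R=(a_1,b_1)\times\cdots\times(a_d,b_d)\subseteq(0,1)^d$ and $1\le i\le d$, put $c_i(j)=a_i+\frac{j}{p}(b_i-a_i)$ for $0\le j\le p$. The $p$-splitting of $R$ in the coordinate $i$ is the set of $p$ open rectangles \[ H_i(R)=\{(a_1,b_1)\times\cdots\times(c_i(j-1),c_i(j))\times\cdots\times(a_d,b_d) : 1\le j\le p\}, \] where only the $i$-th factor is changed. Fix an integer $m\ge 0$, start with $S_0=\{(0,1)^d\}$, and for $k=1,\dots,m$ choose any $R\in S_{k-1}$ and any $1\le i\le d$ and set $S_k=(S_{k-1}\setminus\{R\})\cup H_i(R)$. Any resulting set $S_m$ is called a $(d,p,n)$-decomposition, where $n=1+m(p-1)=|S_m|$. $C_{d,p}(n)$ denotes the number of distinct $(d,p,n)$-decompositions (as sets of rectangles). *)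

theory Defs
  imports "HOL-Analysis.Analysis"
begin

text \<open>
  Points of d-dimensional space are extensional functions on the index set {1..d}, so that the
  dimension is an ordinary natural number.
\<close>

definition rect :: "nat \<Rightarrow> (nat \<Rightarrow> real) \<Rightarrow> (nat \<Rightarrow> real) \<Rightarrow> (nat \<Rightarrow> real) set" where
  "rect d a b = (\<Pi>\<^sub>E i\<in>{1..d}. {a i<..<b i})"

definition cut_point :: "nat \<Rightarrow> (nat \<Rightarrow> real) \<Rightarrow> (nat \<Rightarrow> real) \<Rightarrow> nat \<Rightarrow> nat \<Rightarrow> real" where
  "cut_point p a b i j = a i + real j / real p * (b i - a i)"

definition splitting ::
  "nat \<Rightarrow> nat \<Rightarrow> (nat \<Rightarrow> real) \<Rightarrow> (nat \<Rightarrow> real) \<Rightarrow> nat \<Rightarrow> (nat \<Rightarrow> real) set set" where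
  "splitting d p a b i =
     {rect d (a(i := cut_point p a b i (j - 1))) (b(i := cut_point p a b i j)) | j. j \<in> {1..p}}"

text \<open>
  Splitting is defined on the endpoints. A nonempty rectangle determines its endpoints in the
  coordinates {1..d}, so the splitting is a function of the rectangle as a set of points.
\<close>

lemma rect_eq_imp_endpoints_eq:
  assumes "rect d a b = rect d a' b'" and "\<And>i. i \<in> {1..d} \<Longrightarrow> a i < b i" and "i \<in> {1..d}"
  shows "a i = a' i" and "b i = b' i"
proof -
  let ?F = "\<lambda>i. {a i<..<b i}" and ?G = "\<lambda>i. {a' i<..<b' i}"
  have ne: "?F l \<noteq> {}" if "l \<in> {1..d}" for l
    using assms(2)[OF that] by simp
  have eq: "Pi\<^sub>E {1..d} ?F = Pi\<^sub>E {1..d} ?G"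
    using assms(1) by (simp add: rect_def)
  have "Pi\<^sub>E {1..d} ?F \<noteq> {}"
    using ne unfolding PiE_eq_empty_iff by blast
  then have ne': "?G l \<noteq> {}" if "l \<in> {1..d}" for l
    using that unfolding eq PiE_eq_empty_iff by blast
  have "\<forall>l\<in>{1..d}. ?F l = ?G l"
    using eq by (subst (asm) PiE_eq_iff_not_empty) (use ne ne' in simp_all)
  then have "?F i = ?G i"
    using assms(3) by (rule bspec)
  moreover have "a i < b i" "a' i < b' i"
    using ne[OF assms(3)] ne'[OF assms(3)] by simp_all
  ultimately show "a i = a' i" "b i = b' i"
    by (metis cInf_greaterThanLessThan, metis cSup_greaterThanLessThan)
qed

lemma splitting_cong:
  assumes "rect d a b = rect d a' b'" and "\<And>i. i \<in> {1..d} \<Longrightarrow> a i < b i" and "i \<in> {1..d}"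
  shows "splitting d p a b i = splitting d p a' b' i"
proof -
  note e = rect_eq_imp_endpoints_eq[OF assms(1,2)]
  have "rect d (a(i := x)) (b(i := y)) = rect d (a'(i := x)) (b'(i := y))" for x y
    unfolding rect_def by (rule PiE_cong) (use e in auto)
  moreover have "cut_point p a b i = cut_point p a' b' i"
    using e[of i] assms(3) by (auto simp: cut_point_def fun_eq_iff)
  ultimately show ?thesis by (simp add: splitting_def)
qed

text \<open>The sets of rectangles obtainable from the unit cube by exactly m splittings.\<close>

inductive splits_to :: "nat \<Rightarrow> nat \<Rightarrow> nat \<Rightarrow> (nat \<Rightarrow> real) set set \<Rightarrow> bool" for d p :: nat where
  start: "splits_to d p 0 {rect d (\<lambda>_. 0) (\<lambda>_. 1)}"
| step: "\<lbrakk>splits_to d p m S; rect d a b \<in> S; \<forall>l\<in>{1..d}. a l < b l; i \<in> {1..d}\<rbrakk>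
    \<Longrightarrow> splits_to d p (Suc m) ((S - {rect d a b}) \<union> splitting d p a b i)"

definition decomposition :: "nat \<Rightarrow> nat \<Rightarrow> nat \<Rightarrow> (nat \<Rightarrow> real) set set \<Rightarrow> bool" where
  "decomposition d p n S \<longleftrightarrow> (\<exists>m. n = 1 + m * (p - 1) \<and> splits_to d p m S)"

lemma splits_to_finite: "splits_to d p m S \<Longrightarrow> finite S"
  by (induction rule: splits_to.induct) (simp_all add: splitting_def)

lemma finite_splits_to: "finite {S. splits_to d p m S}"
proof (induction m)
  case 0
  have "{S. splits_to d p 0 S} \<subseteq> {{rect d (\<lambda>_. 0) (\<lambda>_. 1)}}"
    by (auto elim: splits_to.cases)
  then show ?case by (rule finite_subset) simp
next
  case (Suc m)
  define T where "T = (\<lambda>(S, R, i). (S - {R}) \<union> (SOME H. \<exists>a b. R = rect d a b \<and>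
    (\<forall>l\<in>{1..d}. a l < b l) \<and> H = splitting d p a b i))"
  let ?D = "\<Union>S\<in>{S. splits_to d p m S}. {S} \<times> S \<times> {1..d}"
  have "finite ?D"
    by (rule finite_UN_I[OF Suc]) (simp add: splits_to_finite)
  moreover have "{S. splits_to d p (Suc m) S} \<subseteq> T ` ?D"
  proof
    fix S' assume "S' \<in> {S. splits_to d p (Suc m) S}"
    then have "splits_to d p (Suc m) S'" by simp
    then show "S' \<in> T ` ?D"
    proof cases
      case (step S a b i)
      have "(SOME H. \<exists>a' b'. rect d a b = rect d a' b' \<and> (\<forall>l\<in>{1..d}. a' l < b' l) \<and>
          H = splitting d p a' b' i) = splitting d p a b i"
      proof (rule some_equality)
        show "\<exists>a' b'. rect d a b = rect d a' b' \<and> (\<forall>l\<in>{1..d}. a' l < b' l) \<and>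
          splitting d p a b i = splitting d p a' b' i"
          using step(4) by blast
      next
        fix H assume "\<exists>a' b'. rect d a b = rect d a' b' \<and> (\<forall>l\<in>{1..d}. a' l < b' l) \<and>
          H = splitting d p a' b' i"
        then obtain a' b' where "rect d a b = rect d a' b'" "H = splitting d p a' b' i"
          by blast
        then show "H = splitting d p a b i"
          using splitting_cong[of d a b a' b' i p] step(4,5) by metis
      qed
      then have "S' = T (S, rect d a b, i)"
        using step(1) by (simp add: T_def)
      moreover have "(S, rect d a b, i) \<in> ?D"
        using step by blast
      ultimately show ?thesis by (rule image_eqI)
    qed
  qed
  ultimately show ?case
    by (rule finite_surj)
qed

lemma finite_decompositions:
  assumes "p \<ge> 2"
  shows "finite {S. decomposition d p n S}"
proof -
  have "{S. decomposition d p n S} \<subseteq> {S. splits_to d p ((n - 1) div (p - 1)) S}"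
    using assms by (auto simp: decomposition_def)
  then show ?thesis
    using finite_splits_to by (rule finite_subset)
qed

definition num_decompositions :: "nat \<Rightarrow> nat \<Rightarrow> nat \<Rightarrow> nat" where
  "num_decompositions d p n = card {S. decomposition d p n S}"

definition decomposition_ratio :: "nat \<Rightarrow> nat \<Rightarrow> nat \<Rightarrow> real" where
  "decomposition_ratio d p m =
     real (num_decompositions d p ((m + 1) * (p - 1) + 1)) / real (num_decompositions d p (m * (p - 1) + 1))"

definition growth_rate :: "nat \<Rightarrow> nat \<Rightarrow> real" where
  "growth_rate d p = lim (decomposition_ratio d p)"

definition q_poly :: "nat \<Rightarrow> nat \<Rightarrow> real \<Rightarrow> real" where
  "q_poly d p z = (\<Sum>k=0..d. (-1) ^ k * real (d choose k) * z ^ (p ^ k))"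

end

theory Submission
  imports Defs "HOL-Probability.Sinc_Integral" "HOL-Probability.Characteristic_Functions"
    "HOL-Complex_Analysis.Complex_Analysis" "HOL-Real_Asymp.Real_Asymp"
begin

text \<open>
  Since splittings in different coordinates commute, a decomposition that respects the cuts of all
  coordinates in a set \<open>I\<close> is the same thing as an independent choice of decompositions of the
  \<open>p ^ card I\<close> cells of the corresponding grid. A decomposition other than the trivial one respects
  the cuts of at least one coordinate, so inclusion-exclusion shows that the generating function
  \<open>F\<close> of the numbers of decompositions satisfies \<open>q(F) = X\<close>. Writing \<open>q(z) = z Q(z ^ (p - 1))\<close> and
  \<open>n = m (p - 1) + 1\<close>, Lagrange inversion gives that \<open>n\<close> times the \<open>n\<close>-th coefficient of \<open>F\<close> is the
  coefficient of \<open>w ^ m\<close> in \<open>1 / Q(w) ^ n\<close>. This is a Cauchy integral over the circle of radius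
  \<open>r = s ^ (p - 1)\<close>, which passes through the saddle point of the integrand because \<open>q'(s) = 0\<close>. As
  \<open>r\<close> is smaller than \<open>4 / (3dp)\<close>, the terms of \<open>Q\<close> after the linear one are so small that
  \<open>Re Q(w) - Q(r)\<close> is at least a positive multiple of \<open>1 - cos(arg w)\<close> on this circle. The Laplace
  method therefore applies, and the coefficient is asymptotic to a constant times
  \<open>m ^ (-1/2) (1 / q(s) ^ (p - 1)) ^ m\<close>.
\<close>

section \<open>Lagrange inversion\<close>

text \<open>For \<open>j > 0\<close> the series is \<open>- 1 / j\<close> times the derivative of
  \<open>inverse Q ^ j\<close>, and derivatives have no residue. For \<open>j = 0\<close> it is the
  logarithmic derivative of \<open>Q\<close>.\<close>

lemma fls_residue_inverse_power_times_deriv: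
  fixes Q :: "'a :: field_char_0 fls"
  assumes "Q \<noteq> 0"
  shows "fls_residue (inverse Q ^ Suc j * fls_deriv Q) = (if j = 0 then of_int (fls_subdegree Q) else 0)"
proof (cases "j = 0")
  case True
  then show ?thesis
    using fls_residue_deriv_times_inverse_eq_subdegree(2)[of Q] by simp
next
  case False
  then obtain i where i: "j = Suc i" by (cases j) auto
  have "fls_deriv (inverse Q ^ j) = of_nat j * inverse Q ^ i * (- fls_deriv Q * (inverse Q)\<^sup>2)"
    unfolding fls_deriv_power by (simp add: i fls_inverse_deriv)
  then have "fls_deriv (inverse Q ^ j) = - of_nat j * (inverse Q ^ Suc j * fls_deriv Q)"
    by (simp add: i power2_eq_square algebra_simps)
  then have "fls_residue (- of_int (int j) * (inverse Q ^ Suc j * fls_deriv Q)) = 0"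
    using fls_residue_deriv[of "inverse Q ^ j"] by simp
  then have "of_nat j * fls_residue (inverse Q ^ Suc j * fls_deriv Q) = 0"
    using fls_residue_of_int_times(1)[of "- int j" "inverse Q ^ Suc j * fls_deriv Q"] by simp
  then show ?thesis using False by simp
qed

text \<open>Differentiating \<open>F oo q = fps_X\<close> gives \<open>F'(q) q' = 1\<close>. After
  division by \<open>q ^ n\<close>, the term of degree \<open>k\<close> of \<open>F'\<close>
  contributes \<open>q ^ k q' / q ^ n\<close>, whose residue vanishes for every \<open>k\<close>
  except \<open>n - 1\<close>, where it is the subdegree 1 of \<open>q\<close>. So the residue of
  \<open>1 / q ^ n\<close> is the coefficient of degree \<open>n - 1\<close> of
  \<open>F'\<close>.\<close>

theorem fps_lagrange_inversion:
  fixes F q :: "'a :: field_char_0 fps"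
  assumes inv: "F oo q = fps_X" and q0: "fps_nth q 0 = 0" and q1: "fps_nth q 1 \<noteq> 0" and "n \<ge> 1"
  shows "of_nat n * fps_nth F n = fps_nth (inverse (fps_shift 1 q) ^ n) (n - 1)"
proof -
  define Q where "Q = fps_to_fls q"
  define R where "R = fps_shift n (fps_deriv F)"
  define c where "c = fps_nth (fps_deriv F)"
  have "q \<noteq> 0" using q1 by auto
  then have Q0: "Q \<noteq> 0" by (simp add: Q_def)
  have "subdegree q = 1" using q0 q1 by (intro subdegreeI) auto
  then have sub: "fls_subdegree Q = 1" by (simp add: Q_def fls_subdegree_fls_to_fps)
  have cut: "fps_cutoff n (fps_deriv F) oo q = (\<Sum>k<n. fps_const (c k) * q ^ k)"
  proof -
    have "fps_cutoff n (fps_deriv F) = (\<Sum>k<n. fps_const (c k) * fps_X ^ k)"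
      by (rule fps_ext) (auto simp: fps_sum_nth c_def if_distrib cong: if_cong)
    then show ?thesis
      by (simp add: fps_compose_sum_distrib fps_compose_mult_distrib q0 fps_X_power_compose)
  qed
  have "1 = (fps_deriv F oo q) * fps_deriv q"
    using fps_compose_deriv[OF q0, of F] by (simp add: inv)
  also have "fps_deriv F = fps_X ^ n * R + fps_cutoff n (fps_deriv F)"
    unfolding R_def by (rule fps_shift_cutoff'[symmetric])
  also have "(\<dots> oo q) * fps_deriv q =
      (\<Sum>k<n. fps_const (c k) * (q ^ k * fps_deriv q)) + q ^ n * ((R oo q) * fps_deriv q)"
    by (simp add: fps_compose_add_distrib fps_compose_mult_distrib q0 fps_X_power_compose cut
        sum_distrib_left sum_distrib_right algebra_simps)
  finally have "fps_to_fls 1 = fps_to_fls \<dots>" by (rule arg_cong)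
  moreover have "fps_to_fls (\<Sum>k<n. f k) = (\<Sum>k<n. fps_to_fls (f k))" for f :: "nat \<Rightarrow> 'a fps"
    by (induction n) simp_all
  ultimately have one: "1 = (\<Sum>k<n. fls_const (c k) * (Q ^ k * fls_deriv Q)) + Q ^ n * fps_to_fls ((R oo q) * fps_deriv q)"
    by (simp add: Q_def fls_times_fps_to_fls fps_to_fls_power fls_deriv_fps_to_fls)
  have QQ: "inverse Q ^ n * Q ^ k = inverse Q ^ (n - k)" if "k \<le> n" for k
  proof -
    have "inverse Q ^ n = inverse Q ^ (n - k) * inverse Q ^ k"
      using that by (simp flip: power_add)
    then show ?thesis using Q0 by (simp flip: power_mult_distrib add: mult.assoc)
  qed
  have "inverse Q ^ n = inverse Q ^ n * 1" by simp
  also have "\<dots> = (\<Sum>k<n. fls_const (c k) * (inverse Q ^ n * Q ^ k * fls_deriv Q)) +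
      inverse Q ^ n * Q ^ n * fps_to_fls ((R oo q) * fps_deriv q)"
    by (subst one) (simp add: algebra_simps sum_distrib_left)
  \<comment> \<open>The tail of degree at least \<open>n\<close> loses its negative power and
    becomes a power series, which has no residue.\<close>
  also have "\<dots> = (\<Sum>k<n. fls_const (c k) * (inverse Q ^ Suc (n - 1 - k) * fls_deriv Q)) +
      fps_to_fls ((R oo q) * fps_deriv q)"
    using QQ by (simp add: Suc_diff_Suc)
  finally have "inverse Q ^ n = \<dots>" .
  moreover have "fls_residue (\<Sum>k<n. f k) = (\<Sum>k<n. fls_residue (f k))" for f :: "nat \<Rightarrow> 'a fls"
    by (induction n) simp_all
  ultimately have "fls_residue (inverse Q ^ n) =
      (\<Sum>k<n. fls_residue (fls_const (c k) * (inverse Q ^ Suc (n - 1 - k) * fls_deriv Q)))"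
    by (simp del: power_Suc)
  also have "\<dots> = (\<Sum>k<n. c k * (if n - 1 - k = 0 then 1 else 0))"
    unfolding fls_residue_fls_const_times(1) fls_residue_inverse_power_times_deriv[OF Q0] sub
    by (intro sum.cong refl) simp
  also have "\<dots> = (\<Sum>k<n. if k = n - 1 then c k else 0)"
    by (intro sum.cong refl) auto
  also have "\<dots> = c (n - 1)"
    using assms(4) by simp
  also have "\<dots> = of_nat n * fps_nth F n"
    using assms(4) by (simp add: c_def)
  finally have "fls_residue (inverse Q ^ n) = of_nat n * fps_nth F n" .
  \<comment> \<open>With \<open>q = X u\<close>, the power \<open>1 / q ^ n\<close> is
    \<open>1 / u ^ n\<close> shifted by \<open>n\<close>, so degree \<open>n - 1\<close> moves to
    degree -1.\<close>
  moreover have "fls_residue (inverse Q ^ n) = fps_nth (inverse (fps_shift 1 q) ^ n) (n - 1)"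
  proof -
    define u where "u = fps_shift 1 q"
    have u0: "fps_nth u 0 \<noteq> 0" using q1 by (simp add: u_def)
    have "q = fps_X * u"
      by (rule fps_ext) (use q0 in \<open>simp add: u_def\<close>)
    then have "inverse Q = fls_X_inv * fps_to_fls (inverse u)"
      using u0 subdegree_eq_0_iff[of u] by (simp add: Q_def fls_times_fps_to_fls fls_inverse_X fls_inverse_fps_to_fls)
    then have "inverse Q ^ n = fls_X_inv ^ n * fps_to_fls (inverse u ^ n)"
      by (simp add: power_mult_distrib fps_to_fls_power)
    also have "\<dots> = fls_shift (int n) (fps_to_fls (inverse u ^ n))"
      by (simp add: fls_X_inv_power_times_conv_shift)
    finally show ?thesis using assms(4) by (simp add: u_def nat_diff_distrib)
  qed
  ultimately show ?thesis by simp
qed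

text \<open>By associativity \<open>F oo q\<close> and \<open>fps_X\<close> agree after composition
  with \<open>F\<close> on the right, and this composition is injective because \<open>F\<close> is
  nonzero without constant term.\<close>

lemma fps_compose_inverse_commute:
  fixes F q :: "'a :: field fps"
  assumes "q oo F = fps_X" "fps_nth F 0 = 0" "fps_nth q 0 = 0"
  shows "F oo q = fps_X"
proof -
  have "(F oo q) oo F = F oo (q oo F)"
    by (rule fps_compose_assoc[symmetric]) (use assms in auto)
  then have "((F oo q) - fps_X) oo F = 0"
    using assms by (simp add: fps_compose_sub_distrib)
  moreover have "F \<noteq> 0"
  proof
    assume "F = 0"
    then have "fps_X = (0 :: 'a fps)" using assms by simp
    then show False by simp
  qed
  ultimately show ?thesis
    using fps_compose_eq_0_iff[OF assms(2)] by simp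
qed

section \<open>Generating functions of weighted sets\<close>

text \<open>An infinite level would count as 0, the value of \<open>card\<close> on infinite sets;
  the product rules below therefore assume finite levels.\<close>

definition weight_gf :: "('b \<Rightarrow> nat) \<Rightarrow> 'b set \<Rightarrow> 'a :: comm_semiring_1 fps" where
  "weight_gf w A = Abs_fps (\<lambda>n. of_nat (card {x\<in>A. w x = n}))"

lemma weight_gf_nth: "fps_nth (weight_gf w A) n = of_nat (card {x\<in>A. w x = n})"
  by (simp add: weight_gf_def)

lemma bij_betw_level:
  assumes "bij_betw f A B" "\<And>x. x \<in> A \<Longrightarrow> w' (f x) = w x"
  shows "bij_betw f {x\<in>A. w x = n} {y\<in>B. w' y = n}"
  using assms unfolding bij_betw_def inj_on_def by fastforce

lemma weight_gf_bij:
  assumes "bij_betw f A B" "\<And>x. x \<in> A \<Longrightarrow> w' (f x) = w x"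
  shows "weight_gf w A = (weight_gf w' B :: 'a :: comm_semiring_1 fps)"
proof (rule fps_ext)
  fix n
  show "fps_nth (weight_gf w A) n = fps_nth (weight_gf w' B :: 'a fps) n"
    using bij_betw_same_card[OF bij_betw_level[of f A B w' w n]] assms by (simp add: weight_gf_nth)
qed

lemma weight_gf_times:
  assumes "\<And>n. finite {x\<in>A. w x = n}" "\<And>n. finite {y\<in>B. w' y = n}"
  shows "weight_gf (\<lambda>(x, y). w x + w' y) (A \<times> B) = weight_gf w A * weight_gf w' B"
proof (rule fps_ext)
  fix n
  have "{z\<in>A \<times> B. (case z of (x, y) \<Rightarrow> w x + w' y) = n} =
      (\<Union>k\<in>{0..n}. {x\<in>A. w x = k} \<times> {y\<in>B. w' y = n - k})"
    by auto
  also have "card \<dots> = (\<Sum>k\<in>{0..n}. card ({x\<in>A. w x = k} \<times> {y\<in>B. w' y = n - k}))"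
    using assms by (intro card_UN_disjoint) auto
  finally show "fps_nth (weight_gf (\<lambda>(x, y). w x + w' y) (A \<times> B)) n = fps_nth (weight_gf w A * weight_gf w' B) n"
    by (simp add: weight_gf_nth fps_mult_nth card_cartesian_product)
qed

lemma finite_level_PiE:
  assumes "finite J" "\<And>j n. j \<in> J \<Longrightarrow> finite {x\<in>A j. w x = n}"
  shows "finite {f\<in>PiE J A. (\<Sum>j\<in>J. w (f j)) = (n::nat)}"
proof (rule finite_subset)
  show "{f\<in>PiE J A. (\<Sum>j\<in>J. w (f j)) = n} \<subseteq> PiE J (\<lambda>j. \<Union>k\<in>{..n}. {x\<in>A j. w x = k})"
  proof
    fix f assume f: "f \<in> {f\<in>PiE J A. (\<Sum>j\<in>J. w (f j)) = n}"
    then have "w (f j) \<le> n" if "j \<in> J" for j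
      using member_le_sum[OF that, of "\<lambda>j. w (f j)"] assms(1) by auto
    with f show "f \<in> PiE J (\<lambda>j. \<Union>k\<in>{..n}. {x\<in>A j. w x = k})"
      by (auto simp: PiE_iff)
  qed
  show "finite (PiE J (\<lambda>j. \<Union>k\<in>{..n}. {x\<in>A j. w x = k}))"
    using assms by (intro finite_PiE finite_UN_I) auto
qed

text \<open>A function on \<open>insert i J\<close> is a value at \<open>i\<close> together with a
  function on \<open>J\<close>, so induction reduces the claim to the product of two sets.\<close>

lemma weight_gf_PiE:
  assumes "finite J" "\<And>j n. j \<in> J \<Longrightarrow> finite {x\<in>A j. w x = n}"
  shows "weight_gf (\<lambda>f. \<Sum>j\<in>J. w (f j)) (PiE J A) = (\<Prod>j\<in>J. weight_gf w (A j) :: 'a :: comm_semiring_1 fps)"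
  using assms
proof (induction J rule: finite_induct)
  case empty
  have "weight_gf (\<lambda>f. \<Sum>j\<in>{}. w (f j)) (PiE {} A) = (1 :: 'a fps)"
    by (rule fps_ext) (simp add: weight_gf_nth)
  then show ?case by simp
next
  case (insert i J)
  have "weight_gf (\<lambda>f. \<Sum>j\<in>insert i J. w (f j)) (PiE (insert i J) A) =
      (weight_gf (\<lambda>(x, f). w x + (\<Sum>j\<in>J. w (f j))) (A i \<times> PiE J A) :: 'a fps)"
  proof (rule weight_gf_bij[symmetric])
    show "bij_betw (\<lambda>(y, g). g(i := y)) (A i \<times> PiE J A) (PiE (insert i J) A)"
      unfolding bij_betw_def PiE_insert_eq using inj_combinator[OF insert(2), of A] by simp
    fix z assume "z \<in> A i \<times> PiE J A"
    have "(\<Sum>j\<in>J. w (if j = i then x else f j)) = (\<Sum>j\<in>J. w (f j))" for x f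
      using insert(2) by (intro sum.cong) auto
    then show "(\<Sum>j\<in>insert i J. w ((case z of (y, g) \<Rightarrow> g(i := y)) j)) =
        (case z of (x, f) \<Rightarrow> w x + (\<Sum>j\<in>J. w (f j)))"
      using insert(1,2) by (auto split: prod.splits)
  qed
  also have "\<dots> = weight_gf w (A i) * weight_gf (\<lambda>f. \<Sum>j\<in>J. w (f j)) (PiE J A)"
    using insert by (intro weight_gf_times finite_level_PiE) auto
  finally show ?case using insert by simp
qed

lemma sum_Pow_card:
  fixes h :: "nat \<Rightarrow> 'a :: comm_semiring_1"
  assumes "finite A"
  shows "(\<Sum>I\<in>Pow A. h (card I)) = (\<Sum>k=0..card A. of_nat (card A choose k) * h k)"
proof -
  have "(\<Sum>I\<in>Pow A. h (card I)) = (\<Sum>k\<in>{0..card A}. \<Sum>I\<in>{I\<in>Pow A. card I = k}. h (card I))"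
    using assms by (intro sum.group[symmetric]) (auto intro: card_mono)
  also have "\<dots> = (\<Sum>k=0..card A. of_nat (card A choose k) * h k)"
  proof (rule sum.cong)
    fix k
    have "(\<Sum>I\<in>{I\<in>Pow A. card I = k}. h (card I)) = of_nat (card {I. I \<subseteq> A \<and> card I = k}) * h k"
      by (simp add: Pow_def)
    then show "(\<Sum>I\<in>{I\<in>Pow A. card I = k}. h (card I)) = of_nat (card A choose k) * h k"
      using n_subsets[OF assms] by simp
  qed simp
  finally show ?thesis .
qed

text \<open>The sum is the expansion of the product of the factors \<open>1 - 1\<close> over
  \<open>A\<close>.\<close>

lemma sum_Pow_alternating:
  assumes "finite A"
  shows "(\<Sum>I\<in>Pow A. (-1) ^ card I) = (if A = {} then 1 else 0 :: 'a :: comm_ring_1)"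
proof -
  have "(\<Sum>I\<in>Pow A. (-1) ^ card I) = (\<Prod>x\<in>A. 1 - (1::'a))"
    using prod_diff_conv_sum[OF assms, of "\<lambda>_. 1 :: 'a" "\<lambda>_. 1"] by simp
  then show ?thesis using assms by (cases "A = {}") (simp_all add: power_0_left)
qed

section \<open>The Laplace method for circle integrals\<close>

lemma abs_sin_of_nat_mult_le: "\<bar>sin (of_nat n * x)\<bar> \<le> of_nat n * \<bar>sin x :: real\<bar>"
proof (induction n)
  case (Suc n)
  have "\<bar>sin (of_nat (Suc n) * x)\<bar> = \<bar>sin (of_nat n * x) * cos x + cos (of_nat n * x) * sin x\<bar>"
    by (simp add: sin_add algebra_simps)
  also have "\<dots> \<le> \<bar>sin (of_nat n * x)\<bar> * \<bar>cos x\<bar> + \<bar>cos (of_nat n * x)\<bar> * \<bar>sin x\<bar>"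
    by (simp flip: abs_mult)
  also have "\<dots> \<le> \<bar>sin (of_nat n * x)\<bar> * 1 + 1 * \<bar>sin x\<bar>"
    by (intro add_mono mult_left_mono mult_right_mono) auto
  finally show ?case using Suc by (simp add: algebra_simps)
qed simp

text \<open>The half-angle formula turns this into the square of
  \<open>abs_sin_of_nat_mult_le\<close>. It serves to compare the higher harmonics of
  \<open>Q\<close> on a circle with the first one.\<close>

lemma one_minus_cos_of_nat_mult_le: "1 - cos (of_nat n * x) \<le> (of_nat n)\<^sup>2 * (1 - cos x :: real)"
proof -
  have half: "1 - cos y = 2 * (sin (y / 2))\<^sup>2" for y :: real
    using cos_double_sin[of "y / 2"] by simp
  have "\<bar>sin (of_nat n * (x / 2))\<bar>\<^sup>2 \<le> (of_nat n * \<bar>sin (x / 2)\<bar>)\<^sup>2"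
    by (intro power_mono abs_sin_of_nat_mult_le) auto
  then show ?thesis by (simp add: half power_mult_distrib)
qed

text \<open>Taylor's formula gives \<open>x^2 / 2 - x^4 / 24\<close> as a lower bound, and
  \<open>x^2 \<le> 10\<close> on the interval leaves \<open>x^2 / 12\<close>. Only the positivity of
  the constant matters later.\<close>

lemma one_minus_cos_ge:
  fixes x :: real
  assumes "\<bar>x\<bar> \<le> pi"
  shows "1 - cos x \<ge> x\<^sup>2 / 20"
proof -
  have "\<bar>Re (iexp x - (\<Sum>k\<le>3. (\<i> * x) ^ k / fact k))\<bar> \<le> \<bar>x\<bar> ^ Suc 3 / fact (Suc 3)"
    using abs_Re_le_cmod iexp_approx1[of x 3] by (rule order_trans)
  moreover have "Re (iexp x - (\<Sum>k\<le>3. (\<i> * x) ^ k / fact k)) = cos x - 1 + x\<^sup>2 / 2"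
    by (simp add: numeral_3_eq_3 Re_exp power2_eq_square fact_numeral)
  moreover have "\<bar>x\<bar> ^ Suc 3 / fact (Suc 3) = x ^ 4 / 24"
    by (simp add: fact_numeral)
  ultimately have "\<bar>cos x - 1 + x\<^sup>2 / 2\<bar> \<le> x ^ 4 / 24"
    by (simp only:)
  moreover have "x ^ 4 = x\<^sup>2 * x\<^sup>2" by (simp flip: power_add)
  ultimately have "\<bar>cos x - 1 + x\<^sup>2 / 2\<bar> \<le> x\<^sup>2 * x\<^sup>2 / 24" by (simp only:)
  with abs_ge_self have "cos x - 1 + x\<^sup>2 / 2 \<le> x\<^sup>2 * x\<^sup>2 / 24" by (rule order_trans)
  then have "1 - cos x \<ge> x\<^sup>2 / 2 - x\<^sup>2 * x\<^sup>2 / 24" by linarith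
  moreover have "x\<^sup>2 * x\<^sup>2 \<le> x\<^sup>2 * 10"
  proof -
    have "\<bar>x\<bar>\<^sup>2 \<le> 3.15\<^sup>2"
      using assms pi_approx by (intro power_mono) auto
    then have "x\<^sup>2 \<le> 10" by (simp add: power2_eq_square)
    then show ?thesis by (rule mult_left_mono) simp
  qed
  ultimately show ?thesis using zero_le_power2[of x] by linarith
qed

text \<open>In Caratheodory's form of the derivative, \<open>Ln w = g w * (w - 1)\<close> with
  \<open>g\<close> continuous at 1 and \<open>g 1 = 1\<close>. Hence
  \<open>n Ln (1 + z n / n)\<close> equals \<open>g (1 + z n / n) * z n\<close>, which tends to
  \<open>c\<close>.\<close>

lemma tendsto_one_plus_over_n_power:
  fixes z :: "nat \<Rightarrow> complex"
  assumes "z \<longlonglongrightarrow> c"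
  shows "(\<lambda>n. (1 + z n / of_nat n) ^ n) \<longlonglongrightarrow> exp c"
proof -
  have "(Ln has_field_derivative 1) (at 1)"
    using has_field_derivative_Ln[of 1] by simp
  then obtain g where g: "\<And>w. Ln w - Ln 1 = g w * (w - 1)" "isCont g 1" "g 1 = 1"
    unfolding CARAT_DERIV by blast
  have "(\<lambda>n. z n * (1 / of_nat n)) \<longlonglongrightarrow> c * 0"
    by (intro tendsto_mult assms lim_1_over_n)
  then have h: "(\<lambda>n. 1 + z n / of_nat n) \<longlonglongrightarrow> 1 + 0"
    by (intro tendsto_add tendsto_const) simp
  then have "(\<lambda>n. g (1 + z n / of_nat n)) \<longlonglongrightarrow> g 1"
    using isCont_tendsto_compose[OF g(2)] by simp
  then have "(\<lambda>n. exp (g (1 + z n / of_nat n) * z n)) \<longlonglongrightarrow> exp (1 * c)"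
    using assms g(3) by (intro tendsto_intros) auto
  moreover have "\<forall>\<^sub>F n in sequentially. 1 + z n / of_nat n \<noteq> 0"
    using tendsto_imp_eventually_ne[OF h, of 0] by simp
  then have "\<forall>\<^sub>F n in sequentially. exp (g (1 + z n / of_nat n) * z n) = (1 + z n / of_nat n) ^ n"
    using eventually_gt_at_top[of 0]
  proof eventually_elim
    case (elim n)
    have "g (1 + z n / of_nat n) * z n = of_nat n * Ln (1 + z n / of_nat n)"
      using g(1)[of "1 + z n / of_nat n"] elim by simp
    then show ?case
      using elim by (simp add: exp_of_nat_mult)
  qed
  ultimately show ?thesis
    using Lim_transform_eventually by fastforce
qed

text \<open>With \<open>y = x / sqrt n\<close> the quadratic Taylor term contributes exactly the
  limit, and \<open>n\<close> times the cubic remainder \<open>\<bar>y\<bar> ^ 3 / 6\<close> is of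
  order \<open>1 / sqrt n\<close>.\<close>

lemma iexp_second_order_limit:
  fixes x :: real
  shows "(\<lambda>n. of_nat n * (iexp (x / sqrt n) - 1 - \<i> * of_real (x / sqrt n))) \<longlonglongrightarrow> of_real (- x\<^sup>2 / 2)"
proof (rule LIM_zero_cancel, rule Lim_null_comparison)
  show "(\<lambda>n. \<bar>x\<bar> ^ 3 / 6 * (1 / sqrt n)) \<longlonglongrightarrow> 0"
    by real_asymp
  show "\<forall>\<^sub>F n in sequentially. norm (of_nat n * (iexp (x / sqrt n) - 1 - \<i> * of_real (x / sqrt n)) - of_real (- x\<^sup>2 / 2))
      \<le> \<bar>x\<bar> ^ 3 / 6 * (1 / sqrt n)"
    using eventually_gt_at_top[of 0]
  proof eventually_elim
    case (elim n)
    define y where "y = x / sqrt n"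
    have ny: "real n * y\<^sup>2 = x\<^sup>2" using elim by (simp add: y_def power_divide)
    have "(\<Sum>k\<le>2. (\<i> * of_real y) ^ k / fact k) = 1 + \<i> * of_real y - of_real (y\<^sup>2) / 2"
      by (simp add: numeral_2_eq_2 power2_eq_square complex_eq_iff)
    then have "norm (iexp y - (1 + \<i> * of_real y - of_real (y\<^sup>2) / 2)) \<le> \<bar>y\<bar> ^ 3 / 6"
      using iexp_approx1[of y 2] by (simp add: fact_numeral)
    then have "real n * norm (iexp y - (1 + \<i> * of_real y - of_real (y\<^sup>2) / 2)) \<le> real n * (\<bar>y\<bar> ^ 3 / 6)"
      by (rule mult_left_mono) simp
    moreover have "real n * (\<bar>y\<bar> ^ 3 / 6) = \<bar>x\<bar> ^ 3 / 6 * (1 / sqrt n)"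
    proof -
      have "real n * \<bar>y\<bar> ^ 3 = (real n * y\<^sup>2) * \<bar>y\<bar>"
        by (simp add: power3_eq_cube power2_eq_square)
      then show ?thesis unfolding ny by (simp add: y_def power3_eq_cube power2_eq_square)
    qed
    moreover have "of_nat n * (iexp y - 1 - \<i> * of_real y) - of_real (- x\<^sup>2 / 2) =
        of_nat n * (iexp y - (1 + \<i> * of_real y - of_real (y\<^sup>2) / 2))"
    proof -
      have "(of_real (x\<^sup>2) :: complex) = of_nat n * of_real (y\<^sup>2)"
        unfolding ny[symmetric] by simp
      then show ?thesis by (simp add: algebra_simps)
    qed
    then have "norm (of_nat n * (iexp y - 1 - \<i> * of_real y) - of_real (- x\<^sup>2 / 2)) =
        real n * norm (iexp y - (1 + \<i> * of_real y - of_real (y\<^sup>2) / 2))"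
      by (simp only: norm_mult norm_of_nat)
    ultimately show ?case unfolding y_def by simp
  qed
qed

lemma integrable_inverse_one_plus_square:
  fixes b :: real
  assumes "b > 0"
  shows "integrable lborel (\<lambda>u. 1 / (1 + b * u\<^sup>2))"
proof -
  have "integrable lborel (\<lambda>x::real. inverse (1 + x\<^sup>2))"
    using integrable_inverse_1_plus_square by (simp add: set_integrable_def)
  then have "integrable lborel (\<lambda>x::real. inverse (1 + (0 + sqrt b * x)\<^sup>2))"
    using assms by (intro lborel_integrable_real_affine) auto
  then show ?thesis
    using assms by (simp add: power_mult_distrib inverse_eq_divide)
qed

text \<open>The substitution \<open>t = u / sqrt m\<close> absorbs the factor \<open>sqrt m\<close>,
  and the integrand then tends pointwise to \<open>\<phi> 0 * exp (- A * u^2)\<close>. Bernoulli's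
  inequality \<open>(1 + b t^2) ^ m \<ge> 1 + b m t^2 = 1 + b u^2\<close> supplies an integrable
  bound that does not depend on \<open>m\<close>, so dominated convergence applies.\<close>

lemma laplace_limit:
  fixes L \<phi> :: "real \<Rightarrow> complex" and a b A :: real
  assumes contL: "continuous_on {-a..a} L" and cont\<phi>: "continuous_on {-a..a} \<phi>"
    and "a > 0" "b > 0" and \<phi>0: "\<phi> 0 \<noteq> 0"
    and bound: "\<And>t. t \<in> {-a..a} \<Longrightarrow> norm (L t) \<le> 1 / (1 + b * t\<^sup>2)"
    and lim: "\<And>u. (\<lambda>m. L (u / sqrt m) ^ m) \<longlonglongrightarrow> of_real (exp (- A * u\<^sup>2))"
  obtains K where "K \<noteq> 0" "(\<lambda>m. sqrt m * (LINT t:{-a..a}|lborel. \<phi> t * L t ^ m)) \<longlonglongrightarrow> K"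
proof -
  define F where "F = (\<lambda>m t. indicator {-a..a} t *\<^sub>R (\<phi> t * L t ^ m))"
  \<comment> \<open>The index starts at 1 so that the scale factor \<open>1 / sqrt (Suc m)\<close>
    is never zero.\<close>
  define s where "s = (\<lambda>m u. F (Suc m) (u / sqrt (Suc m)))"
  define f where "f = (\<lambda>u::real. \<phi> 0 * of_real (exp (- A * u\<^sup>2)))"
  obtain B where B: "\<And>t. t \<in> {-a..a} \<Longrightarrow> norm (\<phi> t) \<le> B"
  proof -
    have "compact (\<phi> ` {-a..a})" using cont\<phi> by (intro compact_continuous_image) auto
    then obtain B where "\<And>z. z \<in> \<phi> ` {-a..a} \<Longrightarrow> norm z \<le> B"
      using compact_imp_bounded bounded_iff by metis
    then show ?thesis using that by blast
  qed
  have B0: "B \<ge> 0" using order_trans[OF norm_ge_zero B[of 0]] \<open>a > 0\<close> by simp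
  have FM [measurable]: "F m \<in> borel_measurable borel" for m
    unfolding F_def by (intro borel_measurable_continuous_on_indicator continuous_intros contL cont\<phi>) auto
  have sM: "s m \<in> borel_measurable lborel" for m
    unfolding s_def by measurable
  have fM: "f \<in> borel_measurable lborel"
    unfolding f_def by measurable
  have w: "integrable lborel (\<lambda>u. B * (1 / (1 + b * u\<^sup>2)))"
    by (intro integrable_mult_right integrable_inverse_one_plus_square \<open>b > 0\<close>)
  have lim_s: "(\<lambda>m. s m u) \<longlonglongrightarrow> f u" for u
  proof -
    have u0: "(\<lambda>m. u / sqrt (real m)) \<longlonglongrightarrow> 0" by real_asymp
    have "isCont \<phi> 0"
      using cont\<phi> \<open>a > 0\<close> by (intro continuous_on_interior[OF cont\<phi>]) auto
    then have "(\<lambda>m. \<phi> (u / sqrt (real m))) \<longlonglongrightarrow> \<phi> 0"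
      using u0 by (rule isCont_tendsto_compose)
    then have "(\<lambda>m. \<phi> (u / sqrt m) * L (u / sqrt m) ^ m) \<longlonglongrightarrow> f u"
      unfolding f_def by (intro tendsto_mult lim)
    moreover have "\<forall>\<^sub>F m in sequentially. u / sqrt (real m) \<in> {-a<..<a}"
      using u0 \<open>a > 0\<close> by (intro topological_tendstoD) auto
    then have "\<forall>\<^sub>F m in sequentially. \<phi> (u / sqrt m) * L (u / sqrt m) ^ m = F m (u / sqrt m)"
      by eventually_elim (auto simp: F_def)
    ultimately have "(\<lambda>m. F m (u / sqrt m)) \<longlonglongrightarrow> f u"
      by (rule Lim_transform_eventually)
    then show ?thesis unfolding s_def by (rule LIMSEQ_Suc)
  qed
  have bound_s: "norm (s m u) \<le> B * (1 / (1 + b * u\<^sup>2))" for m u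
  proof (cases "u / sqrt (Suc m) \<in> {-a..a}")
    case True
    define t where "t = u / sqrt (Suc m)"
    have "norm (L t) ^ Suc m \<le> (1 / (1 + b * t\<^sup>2)) ^ Suc m"
      using bound True by (intro power_mono) (auto simp: t_def)
    also have "\<dots> = 1 / (1 + b * t\<^sup>2) ^ Suc m" by (simp add: power_divide)
    also have "\<dots> \<le> 1 / (1 + b * u\<^sup>2)"
    proof (rule divide_left_mono)
      have "1 + of_nat (Suc m) * (b * t\<^sup>2) \<le> (1 + b * t\<^sup>2) ^ Suc m"
      proof (rule Bernoulli_inequality)
        have "0 \<le> b * t\<^sup>2" using \<open>b > 0\<close> by simp
        then show "-1 \<le> b * t\<^sup>2" by linarith
      qed
      moreover have "real (Suc m) * t\<^sup>2 = u\<^sup>2" by (simp add: t_def power_divide)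
      ultimately show "1 + b * u\<^sup>2 \<le> (1 + b * t\<^sup>2) ^ Suc m" by (simp add: mult.left_commute)
      show "0 < (1 + b * t\<^sup>2) ^ Suc m * (1 + b * u\<^sup>2)"
        using \<open>b > 0\<close> by (intro mult_pos_pos zero_less_power add_pos_nonneg) auto
    qed auto
    finally have "norm (\<phi> t) * norm (L t) ^ Suc m \<le> B * (1 / (1 + b * u\<^sup>2))"
      using B[of t] True B0 by (intro mult_mono) (auto simp: t_def)
    then show ?thesis
      using True by (simp add: s_def F_def t_def norm_mult norm_power)
  next
    case False
    then have "s m u = 0" by (simp add: s_def F_def)
    then show ?thesis using B0 \<open>b > 0\<close> by (simp add: add_nonneg_nonneg)
  qed
  have conv: "(\<lambda>m. integral\<^sup>L lborel (s m)) \<longlonglongrightarrow> integral\<^sup>L lborel f"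
    by (rule integral_dominated_convergence[OF fM sM w]) (use lim_s bound_s in auto)
  \<comment> \<open>The limit inherits the dominating function, and this makes the Gaussian
    integrable.\<close>
  have "integrable lborel f"
    by (rule integrable_dominated_convergence[OF fM sM w, OF AE_I2 AE_I2, OF lim_s bound_s])
  then have "complex_integrable lborel (\<lambda>u. of_real (exp (- A * u\<^sup>2)))"
    using integrable_mult_right[of "inverse (\<phi> 0)" lborel f] \<phi>0 by (simp add: f_def mult.assoc[symmetric] del: of_real_exp)
  then have int: "integrable lborel (\<lambda>u. exp (- A * u\<^sup>2))"
    by (simp only: complex_of_real_integrable_eq)
  have "integral\<^sup>L lborel (\<lambda>u. exp (- A * u\<^sup>2)) \<noteq> 0"
  proof
    assume "integral\<^sup>L lborel (\<lambda>u. exp (- A * u\<^sup>2)) = 0"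
    then have "AE u in lborel. exp (- A * (u::real)\<^sup>2) = 0"
      using integral_nonneg_eq_0_iff_AE[OF int] by simp
    then have "AE u in (lborel :: real measure). False" by simp
    then have "ae_filter (lborel :: real measure) = bot" by (simp only: eventually_False)
    then show False by (simp add: ae_filter_eq_bot_iff)
  qed
  moreover have "integral\<^sup>L lborel f = \<phi> 0 * of_real (integral\<^sup>L lborel (\<lambda>u. exp (- A * u\<^sup>2)))"
    unfolding f_def by (simp only: integral_mult_right_zero integral_complex_of_real)
  ultimately have K: "integral\<^sup>L lborel f \<noteq> 0" using \<phi>0 by simp
  have "integral\<^sup>L lborel (s m) = sqrt (Suc m) * (LINT t:{-a..a}|lborel. \<phi> t * L t ^ Suc m)" for m
  proof -
    have "(LINT t:{-a..a}|lborel. \<phi> t * L t ^ Suc m) = integral\<^sup>L lborel (F (Suc m))"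
      by (simp add: set_lebesgue_integral_def F_def)
    also have "\<dots> = \<bar>1 / sqrt (Suc m)\<bar> *\<^sub>R integral\<^sup>L lborel (\<lambda>u. F (Suc m) (0 + 1 / sqrt (Suc m) * u))"
      by (rule lborel_integral_real_affine) simp
    finally show ?thesis by (simp add: s_def scaleR_conv_of_real field_simps)
  qed
  with conv have "(\<lambda>m. sqrt (Suc m) * (LINT t:{-a..a}|lborel. \<phi> t * L t ^ Suc m)) \<longlonglongrightarrow> integral\<^sup>L lborel f"
    by simp
  then have "(\<lambda>m. sqrt m * (LINT t:{-a..a}|lborel. \<phi> t * L t ^ m)) \<longlonglongrightarrow> integral\<^sup>L lborel f"
    by (rule LIMSEQ_imp_Suc)
  with K show ?thesis by (rule that)
qed

text \<open>This is Cauchy's formula for the derivative of order \<open>m\<close>, parametrised over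
  \<open>{0..2 * pi}\<close>. Periodicity moves the interval to \<open>{-pi..pi}\<close>, so that
  the point \<open>t = 0\<close>, where the integrand will concentrate, is interior.\<close>

lemma fps_nth_eq_circle_integral:
  fixes f :: "complex \<Rightarrow> complex"
  assumes F: "f has_fps_expansion F" and hol: "f holomorphic_on ball 0 R" and r: "0 < r" "r < R"
  shows "2 * pi * fps_nth F m = (LINT t:{-pi..pi}|lborel. f (of_real r * iexp t) / (of_real r * iexp t) ^ m)"
proof -
  define g where "g = (\<lambda>t. f (of_real r * iexp t) / (of_real r * iexp t) ^ m)"
  have inball: "of_real r * iexp t \<in> ball 0 R" for t
    using r by (simp add: norm_mult)
  have contf: "continuous_on (ball 0 R) f" using hol by (rule holomorphic_on_imp_continuous_on)
  have cont: "continuous_on A g" for A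
    unfolding g_def using r inball
    by (intro continuous_intros continuous_on_compose2[OF contf]) auto
  have "((\<lambda>u. f u / (u - 0) ^ Suc m) has_contour_integral (2 * pi * \<i>) / fact m * (deriv ^^ m) f 0) (circlepath 0 r)"
    by (rule Cauchy_has_contour_integral_higher_derivative_circlepath)
       (use r in \<open>auto intro!: continuous_on_subset[OF contf] holomorphic_on_subset[OF hol]\<close>)
  moreover have "(2 * pi * \<i>) / fact m * (deriv ^^ m) f 0 = (2 * pi * \<i>) * fps_nth F m"
    by (simp add: fps_nth_fps_expansion[OF F])
  moreover have "(\<lambda>t. f (0 + of_real r * cis t) / (0 + of_real r * cis t - 0) ^ Suc m * of_real r * \<i> * cis t) = (\<lambda>t. \<i> * g t)"
    using r by (auto simp: g_def cis_conv_exp field_simps)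
  ultimately have "((\<lambda>t. \<i> * g t) has_integral (2 * pi * \<i>) * fps_nth F m) {0..2 * pi}"
    using has_contour_integral_part_circlepath_iff[of 0 "2 * pi"] by (simp add: circlepath_def)
  then have "integral {0..2 * pi} (\<lambda>t. \<i> * g t) = (2 * pi * \<i>) * fps_nth F m"
    by (rule integral_unique)
  then have 1: "integral {0..2 * pi} g = 2 * pi * fps_nth F m"
    by simp
  have per: "g (t + 2 * pi) = g t" for t
  proof -
    have "iexp (t + 2 * pi) = iexp t"
      using exp_plus_2pin[of "\<i> * of_real t" 1] by (simp add: algebra_simps)
    then show ?thesis by (simp only: g_def)
  qed
  have "integral {-pi..pi} g = integral {-pi..0} g + integral {0..pi} g"
    using integrable_continuous_interval[OF cont] by (intro Henstock_Kurzweil_Integration.integral_combine[symmetric]) auto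
  also have "integral {-pi..0} g = integral {-pi..0} (g \<circ> (\<lambda>t. t + 2 * pi))"
    by (simp add: o_def per)
  also have "\<dots> = integral {-pi + 2 * pi..0 + 2 * pi} g"
    by (rule integral_shift[OF cont])
  also have "\<dots> + integral {0..pi} g = integral {0..2 * pi} g"
    using integrable_continuous_interval[OF cont, of 0 "2 * pi"]
      Henstock_Kurzweil_Integration.integral_combine[of 0 pi "2 * pi" g] by (simp add: add.commute)
  finally have "integral {-pi..pi} g = 2 * pi * fps_nth F m"
    by (simp only: 1)
  moreover have "(LINT t:{-pi..pi}|lborel. g t) = integral {-pi..pi} g"
    by (intro set_borel_integral_eq_integral(2)) (simp add: set_integrable_def borel_integrable_compact cont)
  ultimately show ?thesis by (simp add: g_def)
qed

section \<open>The functional equation\<close>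

locale splits =
  fixes d p :: nat
  assumes p2: "p \<ge> 2"
begin

section \<open>Cells of a single splitting\<close>

abbreviation proper :: "(nat \<Rightarrow> real) \<Rightarrow> (nat \<Rightarrow> real) \<Rightarrow> bool" where
  "proper a b \<equiv> \<forall>l\<in>{1..d}. a l < b l"

text \<open>A cell is handled through its endpoint functions because it has to be split again. The
  pieces are numbered from 1, hence \<open>j - 1\<close> for the lower end.\<close>

definition lower :: "(nat \<Rightarrow> real) \<Rightarrow> (nat \<Rightarrow> real) \<Rightarrow> nat \<Rightarrow> nat \<Rightarrow> nat \<Rightarrow> real" where
  "lower a b i j = a(i := cut_point p a b i (j - 1))"

definition upper :: "(nat \<Rightarrow> real) \<Rightarrow> (nat \<Rightarrow> real) \<Rightarrow> nat \<Rightarrow> nat \<Rightarrow> nat \<Rightarrow> real" where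
  "upper a b i j = b(i := cut_point p a b i j)"

definition cell :: "(nat \<Rightarrow> real) \<Rightarrow> (nat \<Rightarrow> real) \<Rightarrow> nat \<Rightarrow> nat \<Rightarrow> (nat \<Rightarrow> real) set" where
  "cell a b i j = rect d (lower a b i j) (upper a b i j)"

lemma splitting_eq: "splitting d p a b i = cell a b i ` {1..p}"
  by (auto simp: splitting_def cell_def lower_def upper_def)

lemma mem_rect: "x \<in> rect d a b \<longleftrightarrow> x \<in> extensional {1..d} \<and> (\<forall>l\<in>{1..d}. a l < x l \<and> x l < b l)"
  by (auto simp: rect_def PiE_iff)

lemma rect_nonempty: "proper a b \<Longrightarrow> rect d a b \<noteq> {}"
  by (auto simp: rect_def PiE_eq_empty_iff)

lemma cut_point_mono:
  assumes "a i < b i" and "j \<le> k" shows "cut_point p a b i j \<le> cut_point p a b i k"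
  using assms by (auto simp: cut_point_def intro!: mult_right_mono divide_right_mono)

lemma cut_point_strict_mono:
  assumes "a i < b i" and "j < k" shows "cut_point p a b i j < cut_point p a b i k"
  using assms p2 by (auto simp: cut_point_def intro!: mult_strict_right_mono divide_strict_right_mono)

lemma cut_point_ends [simp]: "cut_point p a b i 0 = a i" "cut_point p a b i p = b i"
  using p2 by (auto simp: cut_point_def)

lemma proper_cell:
  assumes "proper a b" "i \<in> {1..d}" "j \<in> {1..p}"
  shows "proper (lower a b i j) (upper a b i j)"
  using assms cut_point_strict_mono[of a i b "j - 1" j] by (auto simp: lower_def upper_def)

lemma mem_cell:
  assumes "proper a b" "i \<in> {1..d}" "j \<in> {1..p}"
  shows "x \<in> cell a b i j \<longleftrightarrow>
    x \<in> rect d a b \<and> cut_point p a b i (j - 1) < x i \<and> x i < cut_point p a b i j"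
proof -
  have i: "a i < b i" and j: "j \<le> p" using assms by auto
  have "a i \<le> cut_point p a b i (j - 1)"
    using cut_point_mono[of a i b 0 "j - 1"] i by simp
  moreover have "cut_point p a b i j \<le> b i"
    using cut_point_mono[of a i b j p] i j by simp
  moreover have "x \<in> cell a b i j \<longleftrightarrow> x \<in> extensional {1..d} \<and>
      (\<forall>l\<in>{1..d} - {i}. a l < x l \<and> x l < b l) \<and> cut_point p a b i (j - 1) < x i \<and> x i < cut_point p a b i j"
    unfolding cell_def mem_rect lower_def upper_def using assms(2) by fastforce
  moreover have "x \<in> rect d a b \<longleftrightarrow> x \<in> extensional {1..d} \<and>
      (\<forall>l\<in>{1..d} - {i}. a l < x l \<and> x l < b l) \<and> a i < x i \<and> x i < b i"
    unfolding mem_rect using assms(2) by blast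
  ultimately show ?thesis by (smt (verit))
qed

lemma cell_subset: "proper a b \<Longrightarrow> i \<in> {1..d} \<Longrightarrow> j \<in> {1..p} \<Longrightarrow> cell a b i j \<subseteq> rect d a b"
  by (simp add: mem_cell subset_iff)

lemma cell_nonempty: "proper a b \<Longrightarrow> i \<in> {1..d} \<Longrightarrow> j \<in> {1..p} \<Longrightarrow> cell a b i j \<noteq> {}"
  unfolding cell_def by (intro rect_nonempty proper_cell)

lemma cell_disjoint:
  assumes "proper a b" "i \<in> {1..d}" "j \<in> {1..p}" "k \<in> {1..p}" "j \<noteq> k"
  shows "cell a b i j \<inter> cell a b i k = {}"
  using assms
proof (induction j k rule: linorder_wlog)
  case (le j k)
  then have "cut_point p a b i j \<le> cut_point p a b i (k - 1)"
    by (intro cut_point_mono) auto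
  then show ?case
    using le by (auto simp: mem_cell)
qed (simp add: Int_commute)

lemma cell_unique:
  assumes "proper a b" "i \<in> {1..d}" "j \<in> {1..p}" "k \<in> {1..p}"
    and "R \<noteq> {}" "R \<subseteq> cell a b i j" "R \<subseteq> cell a b i k"
  shows "j = k"
  using cell_disjoint[OF assms(1-4)] assms(5-7) by blast

lemma cell_inj:
  assumes "proper a b" "i \<in> {1..d}" shows "inj_on (cell a b i) {1..p}"
proof (rule inj_onI)
  fix j k assume jk: "j \<in> {1..p}" "k \<in> {1..p}" "cell a b i j = cell a b i k"
  then show "j = k"
    using cell_unique[OF assms jk(1,2) cell_nonempty[OF assms jk(1)]] by simp
qed

text \<open>Since \<open>p \<ge> 2\<close> there is a second cell; it would be contained in the
  first one although different cells are disjoint.\<close>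

lemma rect_not_subset_cell:
  assumes "proper a b" "i \<in> {1..d}" "j \<in> {1..p}"
  shows "\<not> rect d a b \<subseteq> cell a b i j"
proof
  assume *: "rect d a b \<subseteq> cell a b i j"
  obtain k where k: "k \<in> {1..p}" "k \<noteq> j"
    using p2 that[of 1] that[of 2] by (cases "j = 1") auto
  have "cell a b i k \<subseteq> cell a b i j"
    using cell_subset[OF assms(1,2) k(1)] * by blast
  with cell_unique[OF assms(1,2,3) k(1) cell_nonempty[OF assms(1,2) k(1)]] k show False
    by blast
qed

lemma lower_upper_commute:
  assumes "i \<noteq> i'"
  shows "lower (lower a b i' j') (upper a b i' j') i j = lower (lower a b i j) (upper a b i j) i' j'"
    and "upper (lower a b i' j') (upper a b i' j') i j = upper (lower a b i j) (upper a b i j) i' j'"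
  using assms by (auto simp: lower_def upper_def cut_point_def fun_eq_iff)

text \<open>Cutting in the coordinate \<open>i'\<close> does not move the cut points in the
  coordinate \<open>i\<close>, so both cuts only add independent constraints on the points.\<close>

lemma cell_cell:
  assumes "proper a b" "i \<in> {1..d}" "j \<in> {1..p}" "i' \<in> {1..d}" "j' \<in> {1..p}" "i \<noteq> i'"
  shows "cell (lower a b i' j') (upper a b i' j') i j = cell a b i j \<inter> cell a b i' j'"
proof -
  have "cut_point p (lower a b i' j') (upper a b i' j') i k = cut_point p a b i k" for k
    using assms by (auto simp: lower_def upper_def cut_point_def)
  then have "x \<in> cell (lower a b i' j') (upper a b i' j') i j \<longleftrightarrow>
      x \<in> cell a b i' j' \<and> cut_point p a b i (j - 1) < x i \<and> x i < cut_point p a b i j" for x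
    using mem_cell[OF proper_cell[OF assms(1,4,5)] assms(2,3)] by (simp add: cell_def)
  then show ?thesis
    using assms by (auto simp: mem_cell)
qed

section \<open>Decompositions as trees of splittings\<close>

text \<open>This recursion starts at the root, whereas \<open>splits_to\<close> refines the leaves
  one at a time. It applies to arbitrary boxes, as inductions over subboxes require. Different trees
  may yield the same set \<open>S\<close>.\<close>

inductive decomposes :: "(nat \<Rightarrow> real) \<Rightarrow> (nat \<Rightarrow> real) \<Rightarrow> (nat \<Rightarrow> real) set set \<Rightarrow> bool" where
  leaf: "proper a b \<Longrightarrow> decomposes a b {rect d a b}"
| node: "\<lbrakk>proper a b; i \<in> {1..d}; \<And>j. j \<in> {1..p} \<Longrightarrow> decomposes (lower a b i j) (upper a b i j) (S j)\<rbrakk>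
    \<Longrightarrow> decomposes a b (\<Union>j\<in>{1..p}. S j)"

lemma dec_proper: "decomposes a b S \<Longrightarrow> proper a b"
  by (induction rule: decomposes.induct) auto

lemma dec_finite: "decomposes a b S \<Longrightarrow> finite S"
  by (induction rule: decomposes.induct) auto

lemma dec_mem:
  assumes "decomposes a b S" "R \<in> S"
  shows "R \<subseteq> rect d a b" "R \<noteq> {}"
proof -
  have "R \<subseteq> rect d a b \<and> R \<noteq> {}"
    using assms
  proof (induction arbitrary: R rule: decomposes.induct)
    case (leaf a b)
    then show ?case using rect_nonempty by auto
  next
    case (node a b i S)
    then obtain j where "j \<in> {1..p}" "R \<in> S j" by blast
    then have "R \<subseteq> cell a b i j" "R \<noteq> {}"
      using node(4) by (auto simp: cell_def)
    then show ?case
      using cell_subset node(1,2) \<open>j \<in> {1..p}\<close> by blast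
  qed
  then show "R \<subseteq> rect d a b" "R \<noteq> {}" by auto
qed

lemma dec_cell_mem:
  assumes "decomposes (lower a b i j) (upper a b i j) S" "R \<in> S"
  shows "R \<subseteq> cell a b i j"
  using dec_mem(1)[OF assms] by (simp add: cell_def)

lemma dec_cells_disjoint:
  assumes "proper a b" "i \<in> {1..d}" "j \<in> {1..p}" "k \<in> {1..p}" "j \<noteq> k"
    and "decomposes (lower a b i j) (upper a b i j) S" "decomposes (lower a b i k) (upper a b i k) S'"
    and "R \<in> S" "R' \<in> S'"
  shows "R \<inter> R' = {}"
  using cell_disjoint[OF assms(1-5)] dec_cell_mem[OF assms(6,8)] dec_cell_mem[OF assms(7,9)] by blast

lemma dec_disjoint:
  assumes "decomposes a b S" "R \<in> S" "R' \<in> S" "R \<noteq> R'"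
  shows "R \<inter> R' = {}"
  using assms
proof (induction arbitrary: R R' rule: decomposes.induct)
  case (node a b i S)
  then obtain j k where jk: "j \<in> {1..p}" "R \<in> S j" "k \<in> {1..p}" "R' \<in> S k" by blast
  show ?case
  proof (cases "j = k")
    case True
    then show ?thesis using node jk by blast
  next
    case False
    show ?thesis
      using dec_cells_disjoint[OF node(1,2) jk(1,3) False node(3)[OF jk(1)] node(3)[OF jk(3)]] jk
      by blast
  qed
qed auto

text \<open>The induction descends to the leaf being split: at a node, disjointness of the cells
  puts the rectangle into exactly one of the families, and only that family is modified. At the leaf
  the endpoints may differ outside \<open>{1..d}\<close>, which \<open>splitting_cong\<close>
  bridges.\<close>

lemma dec_split:
  assumes "decomposes a b S" "rect d a' b' \<in> S" "proper a' b'" "i \<in> {1..d}"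
  shows "decomposes a b ((S - {rect d a' b'}) \<union> splitting d p a' b' i)"
  using assms
proof (induction rule: decomposes.induct)
  case (leaf a b)
  then have "splitting d p a' b' i = splitting d p a b i"
    using splitting_cong[of d a' b' a b i p] by auto
  also have "\<dots> = (\<Union>j\<in>{1..p}. {rect d (lower a b i j) (upper a b i j)})"
    by (auto simp: splitting_eq cell_def)
  also have "decomposes a b \<dots>"
    using decomposes.node[OF leaf(1) leaf(4), of "\<lambda>j. {rect d (lower a b i j) (upper a b i j)}"]
      decomposes.leaf[OF proper_cell[OF leaf(1) leaf(4)]] by blast
  finally show ?case using leaf by simp
next
  case (node a b i0 S)
  let ?R = "rect d a' b'"
  from node obtain j where j: "j \<in> {1..p}" "?R \<in> S j" by blast
  define S' where "S' = S(j := (S j - {?R}) \<union> splitting d p a' b' i)"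
  have "?R \<notin> S k" if "k \<in> {1..p}" "k \<noteq> j" for k
    using dec_cells_disjoint[OF node(1,2) j(1) that(1) that(2)[symmetric] node(3)[OF j(1)]
       node(3)[OF that(1)] j(2)] rect_nonempty[OF node(6)] by blast
  then have "(\<Union>j\<in>{1..p}. S' j) = (\<Union> (S ` {1..p}) - {?R}) \<union> splitting d p a' b' i"
    using j by (auto simp: S'_def split: if_splits)
  moreover have "decomposes a b (\<Union>j\<in>{1..p}. S' j)"
    using node j by (intro decomposes.node[OF node(1,2)]) (auto simp: S'_def)
  ultimately show ?case by simp
qed

lemma splits_to_dec:
  assumes "splits_to d p m S" shows "decomposes (\<lambda>_. 0) (\<lambda>_. 1) S"
  using assms by (induction rule: splits_to.induct) (auto intro!: decomposes.leaf dec_split)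

text \<open>The \<open>p\<close> new rectangles are nonempty and lie in the removed one, so none of
  them is already present. As \<open>p \<ge> 2\<close>, the number of splittings can be read off
  from \<open>S\<close>.\<close>

lemma card_splits_to:
  assumes "splits_to d p m S" shows "card S = 1 + m * (p - 1)"
  using assms
proof (induction rule: splits_to.induct)
  case (step m S a b i)
  note D = splits_to_dec[OF step(1)]
  have "(S - {rect d a b}) \<inter> splitting d p a b i = {}"
  proof -
    have False if "R \<in> S" "R \<noteq> rect d a b" "R = cell a b i j" "j \<in> {1..p}" for R j
      using dec_disjoint[OF D that(1) step(2) that(2)] cell_subset[OF step(3,4) that(4)] that(3)
        cell_nonempty[OF step(3,4) that(4)] by auto
    then show ?thesis unfolding splitting_eq by blast
  qed
  then have "card ((S - {rect d a b}) \<union> splitting d p a b i) = card (S - {rect d a b}) + card (splitting d p a b i)"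
    using dec_finite[OF D] by (intro card_Un_disjoint) (auto simp: splitting_eq)
  also have "card (splitting d p a b i) = p"
    unfolding splitting_eq using card_image[OF cell_inj[OF step(3,4)]] by simp
  also have "card (S - {rect d a b}) = card S - 1"
    using step dec_finite[OF D] by simp
  finally show ?case
    using step(5) p2 by simp
qed auto

text \<open>The claim is stated inside an arbitrary reachable set \<open>T\<close> so that the
  induction can be applied to the cells of a node one after another while the others are
  present.\<close>

lemma dec_splits_to_aux:
  assumes "decomposes a b S" "splits_to d p m T" "rect d a b \<in> T"
  shows "\<exists>m'. splits_to d p m' ((T - {rect d a b}) \<union> S)"
  using assms
proof (induction arbitrary: T m rule: decomposes.induct)
  case (leaf a b)
  then have "T - {rect d a b} \<union> {rect d a b} = T" by blast
  then show ?case using leaf by auto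
next
  case (node a b i S T m)
  let ?R = "rect d a b"
  note TD = splits_to_dec[OF node(5)]
  \<comment> \<open>Invariant: the first \<open>k\<close> cells are already replaced by their
    decompositions and the remaining ones are still whole.\<close>
  have "\<exists>m'. splits_to d p m' ((T - {?R}) \<union> (\<Union>j\<in>{1..k}. S j) \<union> cell a b i ` {k<..p})" if "k \<le> p" for k
    using that
  proof (induction k)
    case 0
    have "{0<..p} = {1..p}" by auto
    then show ?case
      using splits_to.step[OF node(5,6,1,2)] by (auto simp: splitting_eq)
  next
    case (Suc k)
    let ?T = "(T - {?R}) \<union> (\<Union>j\<in>{1..k}. S j) \<union> cell a b i ` {k<..p}"
    let ?C = "cell a b i (Suc k)"
    have k: "Suc k \<in> {1..p}" using Suc by auto
    obtain m' where m': "splits_to d p m' ?T" using Suc by auto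
    have "?C \<in> ?T" using k by auto
    then obtain m'' where m'': "splits_to d p m'' ((?T - {?C}) \<union> S (Suc k))"
      using node(4)[OF k m'] by (auto simp: cell_def)
    \<comment> \<open>The next three facts show that removing the cell \<open>?C\<close> affects
      nothing but its own entry among the whole cells.\<close>
    have 1: "?C \<notin> T - {?R}"
      using dec_disjoint[OF TD, of ?C ?R] cell_subset[OF node(1,2) k] cell_nonempty[OF node(1,2) k]
        node(6) by blast
    have 2: "?C \<notin> S j" if "j \<in> {1..k}" for j
    proof
      have j: "j \<in> {1..p}" using that k by auto
      assume "?C \<in> S j"
      then have "?C \<subseteq> cell a b i j" using dec_cell_mem[OF node(3)[OF j]] by blast
      then show False
        using cell_unique[OF node(1,2) j k cell_nonempty[OF node(1,2) k]] that by auto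
    qed
    have 3: "?C \<notin> cell a b i ` {Suc k<..p}"
    proof
      assume "?C \<in> cell a b i ` {Suc k<..p}"
      then obtain j where "?C = cell a b i j" "j \<in> {Suc k<..p}" by blast
      with inj_onD[OF cell_inj[OF node(1,2)], of "Suc k" j] k show False by auto
    qed
    have "{k<..p} = insert (Suc k) {Suc k<..p}" "{1..Suc k} = insert (Suc k) {1..k}"
      using k by auto
    with 1 2 3 have "(?T - {?C}) \<union> S (Suc k) =
        (T - {?R}) \<union> (\<Union>j\<in>{1..Suc k}. S j) \<union> cell a b i ` {Suc k<..p}"
      by auto
    with m'' show ?case by auto
  qed
  from this[of p] show ?case by simp
qed

lemma dec_splits_to:
  assumes "decomposes (\<lambda>_. 0) (\<lambda>_. 1) S" shows "\<exists>m. splits_to d p m S"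
  using dec_splits_to_aux[OF assms splits_to.start] by auto

lemma decomposition_iff:
  "decomposition d p n S \<longleftrightarrow> decomposes (\<lambda>_. 0) (\<lambda>_. 1) S \<and> card S = n"
  unfolding decomposition_def using splits_to_dec dec_splits_to card_splits_to by metis

section \<open>Compatibility with the cuts in a coordinate\<close>

text \<open>No rectangle crosses a cut of the box in the coordinate \<open>i\<close>. This condition
  refers to \<open>S\<close> alone and not to a tree that produces it.\<close>

definition compatible :: "nat \<Rightarrow> (nat \<Rightarrow> real) \<Rightarrow> (nat \<Rightarrow> real) \<Rightarrow> (nat \<Rightarrow> real) set set \<Rightarrow> bool" where
  "compatible i a b S \<longleftrightarrow> (\<forall>R\<in>S. \<exists>j\<in>{1..p}. R \<subseteq> cell a b i j)"

text \<open>By \<open>cell_cell\<close> the cells of a cell in another coordinate are the traces of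
  those of the whole box, which makes no difference for rectangles inside that cell.\<close>

lemma compatible_cell:
  assumes "proper a b" "i \<in> {1..d}" "j \<in> {1..p}" "i' \<in> {1..d}" "i \<noteq> i'"
    and "decomposes (lower a b i j) (upper a b i j) S"
  shows "compatible i' (lower a b i j) (upper a b i j) S \<longleftrightarrow> compatible i' a b S"
proof -
  have "R \<subseteq> cell (lower a b i j) (upper a b i j) i' k \<longleftrightarrow> R \<subseteq> cell a b i' k"
    if "R \<in> S" "k \<in> {1..p}" for R k
    unfolding cell_cell[OF assms(1,4) that(2) assms(2,3) assms(5)[symmetric]]
    using dec_cell_mem[OF assms(6) that(1)] by blast
  then show ?thesis
    unfolding compatible_def by (intro ball_cong bex_cong refl) simp
qed

lemma compatible_node:
  assumes "\<And>j. j \<in> {1..p} \<Longrightarrow> decomposes (lower a b i j) (upper a b i j) (S j)"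
  shows "compatible i a b (\<Union>j\<in>{1..p}. S j)"
  unfolding compatible_def
proof
  fix R assume "R \<in> (\<Union>j\<in>{1..p}. S j)"
  then obtain j where "j \<in> {1..p}" "R \<in> S j" by blast
  with dec_cell_mem[OF assms] show "\<exists>j\<in>{1..p}. R \<subseteq> cell a b i j" by blast
qed

text \<open>Splittings in different coordinates commute, so a decomposition all of whose rectangles
  respect the cuts in the coordinate \<open>i\<close> could have started with that splitting.\<close>

lemma dec_compatible_imp_node:
  assumes "decomposes a b S" "i \<in> {1..d}" "compatible i a b S"
  shows "\<exists>S'. (\<forall>j\<in>{1..p}. decomposes (lower a b i j) (upper a b i j) (S' j)) \<and> S = (\<Union>j\<in>{1..p}. S' j)"
  using assms
proof (induction rule: decomposes.induct)
  case (leaf a b)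
  then show ?case using rect_not_subset_cell[OF leaf(1,2)] by (simp add: compatible_def)
next
  case (node a b i' S)
  show ?case
  proof (cases "i = i'")
    case True
    then show ?thesis using node by blast
  next
    case False
    have "compatible i (lower a b i' j') (upper a b i' j') (S j')" if "j' \<in> {1..p}" for j'
      unfolding compatible_cell[OF node(1,2) that node(5) False[symmetric] node(3)[OF that]]
      using node(6) that by (auto simp only: compatible_def)
    then have "\<exists>S'. (\<forall>j\<in>{1..p}. decomposes (lower (lower a b i' j') (upper a b i' j') i j) (upper (lower a b i' j') (upper a b i' j') i j) (S' j))
        \<and> S j' = (\<Union>j\<in>{1..p}. S' j)" if "j' \<in> {1..p}" for j'
      using node(4)[OF that node(5)] that by blast
    then obtain S' where S': "\<And>j j'. j' \<in> {1..p} \<Longrightarrow> j \<in> {1..p} \<Longrightarrow>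
          decomposes (lower (lower a b i' j') (upper a b i' j') i j) (upper (lower a b i' j') (upper a b i' j') i j) (S' j' j)"
        and U: "\<And>j'. j' \<in> {1..p} \<Longrightarrow> S j' = (\<Union>j\<in>{1..p}. S' j' j)"
      by metis
    \<comment> \<open>The subpieces, obtained by cutting \<open>i'\<close> first and then
      \<open>i\<close>, are regrouped by their index in the coordinate \<open>i\<close>; the boxes
      in both orders agree by \<open>lower_upper_commute\<close>.\<close>
    have "decomposes (lower a b i j) (upper a b i j) (\<Union>j'\<in>{1..p}. S' j' j)" if "j \<in> {1..p}" for j
      using S'[OF _ that] lower_upper_commute[OF False]
      by (intro decomposes.node[OF proper_cell[OF node(1) node(5) that] node(2)]) simp
    moreover have "(\<Union> (S ` {1..p})) = (\<Union>j\<in>{1..p}. \<Union>j'\<in>{1..p}. S' j' j)"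
    proof -
      have "(\<Union> (S ` {1..p})) = (\<Union>j'\<in>{1..p}. \<Union>j\<in>{1..p}. S' j' j)"
        by (rule SUP_cong) (simp_all add: U)
      also have "\<dots> = (\<Union>j\<in>{1..p}. \<Union>j'\<in>{1..p}. S' j' j)" by blast
      finally show ?thesis .
    qed
    ultimately show ?thesis
      by (intro exI[of _ "\<lambda>j. \<Union>j'\<in>{1..p}. S' j' j"] conjI ballI) simp_all
  qed
qed

section \<open>Invariance under coordinatewise affine maps\<close>

text \<open>This version acts on endpoint functions at every index. The next one acts on points and
  is restricted to \<open>{1..d}\<close> because points are extensional.\<close>

definition affine_ends :: "(nat \<Rightarrow> real) \<Rightarrow> (nat \<Rightarrow> real) \<Rightarrow> (nat \<Rightarrow> real) \<Rightarrow> nat \<Rightarrow> real" where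
  "affine_ends \<alpha> \<beta> x = (\<lambda>l. \<alpha> l + \<beta> l * x l)"

definition affine_map :: "(nat \<Rightarrow> real) \<Rightarrow> (nat \<Rightarrow> real) \<Rightarrow> (nat \<Rightarrow> real) \<Rightarrow> nat \<Rightarrow> real" where
  "affine_map \<alpha> \<beta> x = restrict (affine_ends \<alpha> \<beta> x) {1..d}"

lemma affine_map_inverse:
  assumes "\<And>l. \<beta> l > 0" "x \<in> extensional {1..d}"
  shows "affine_map (\<lambda>l. - (\<alpha> l / \<beta> l)) (\<lambda>l. 1 / \<beta> l) (affine_map \<alpha> \<beta> x) = x"
    and "affine_map \<alpha> \<beta> (affine_map (\<lambda>l. - (\<alpha> l / \<beta> l)) (\<lambda>l. 1 / \<beta> l) x) = x"
proof -
  have "\<beta> l \<noteq> 0" for l using assms(1)[of l] by simp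
  then show "affine_map (\<lambda>l. - (\<alpha> l / \<beta> l)) (\<lambda>l. 1 / \<beta> l) (affine_map \<alpha> \<beta> x) = x"
    and "affine_map \<alpha> \<beta> (affine_map (\<lambda>l. - (\<alpha> l / \<beta> l)) (\<lambda>l. 1 / \<beta> l) x) = x"
    using assms(2) by (auto simp: affine_map_def affine_ends_def fun_eq_iff extensional_def field_simps)
qed

lemma affine_map_mem:
  assumes "\<And>l. \<beta> l > 0" "x \<in> rect d a b"
  shows "affine_map \<alpha> \<beta> x \<in> rect d (affine_ends \<alpha> \<beta> a) (affine_ends \<alpha> \<beta> b)"
  using assms by (auto simp: mem_rect affine_map_def affine_ends_def)

lemma affine_ends_inverse:
  assumes "\<And>l. \<beta> l > 0"
  shows "affine_ends (\<lambda>l. - (\<alpha> l / \<beta> l)) (\<lambda>l. 1 / \<beta> l) (affine_ends \<alpha> \<beta> x) = x"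
proof -
  have "\<beta> l \<noteq> 0" for l using assms(1)[of l] by simp
  then show ?thesis by (auto simp: affine_ends_def fun_eq_iff field_simps)
qed

lemma affine_map_rect:
  assumes "\<And>l. \<beta> l > 0"
  shows "affine_map \<alpha> \<beta> ` rect d a b = rect d (affine_ends \<alpha> \<beta> a) (affine_ends \<alpha> \<beta> b)"
proof (intro equalityI subsetI)
  fix y assume y: "y \<in> rect d (affine_ends \<alpha> \<beta> a) (affine_ends \<alpha> \<beta> b)"
  let ?x = "affine_map (\<lambda>l. - (\<alpha> l / \<beta> l)) (\<lambda>l. 1 / \<beta> l) y"
  have "?x \<in> rect d a b"
    using affine_map_mem[OF _ y, of "\<lambda>l. 1 / \<beta> l" "\<lambda>l. - (\<alpha> l / \<beta> l)"] assms by (simp add: affine_ends_inverse)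
  moreover have "y = affine_map \<alpha> \<beta> ?x"
    using affine_map_inverse(2)[OF assms] y by (simp add: mem_rect)
  ultimately show "y \<in> affine_map \<alpha> \<beta> ` rect d a b" by blast
qed (use affine_map_mem[OF assms] in auto)

text \<open>Cut points are affine combinations of the endpoints, so affine maps preserve
  them.\<close>

lemma lower_upper_affine_ends:
  "lower (affine_ends \<alpha> \<beta> a) (affine_ends \<alpha> \<beta> b) i j = affine_ends \<alpha> \<beta> (lower a b i j)"
  "upper (affine_ends \<alpha> \<beta> a) (affine_ends \<alpha> \<beta> b) i j = affine_ends \<alpha> \<beta> (upper a b i j)"
  by (auto simp: lower_def upper_def affine_ends_def cut_point_def fun_eq_iff algebra_simps diff_divide_distrib)

lemma dec_affine_map:
  assumes "decomposes a b S" "\<And>l. \<beta> l > 0"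
  shows "decomposes (affine_ends \<alpha> \<beta> a) (affine_ends \<alpha> \<beta> b) ((`) (affine_map \<alpha> \<beta>) ` S)"
proof -
  have proper: "proper (affine_ends \<alpha> \<beta> a) (affine_ends \<alpha> \<beta> b)" if "proper a b" for a b
    using that assms(2) by (simp add: affine_ends_def)
  show ?thesis
    using assms(1)
  proof (induction rule: decomposes.induct)
    case (leaf a b)
    then show ?case
      using decomposes.leaf[OF proper] by (simp add: affine_map_rect assms(2))
  next
    case (node a b i S)
    show ?case
      unfolding image_UN
      by (rule decomposes.node[OF proper[OF node(1)] node(2)]) (use node(4) in \<open>simp only: lower_upper_affine_ends\<close>)
  qed
qed

lemma compatible_affine_map:
  assumes "compatible i a b S" "\<And>l. \<beta> l > 0"
  shows "compatible i (affine_ends \<alpha> \<beta> a) (affine_ends \<alpha> \<beta> b) ((`) (affine_map \<alpha> \<beta>) ` S)"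
proof -
  have "cell (affine_ends \<alpha> \<beta> a) (affine_ends \<alpha> \<beta> b) i j = affine_map \<alpha> \<beta> ` cell a b i j" for j
    by (simp add: cell_def lower_upper_affine_ends affine_map_rect[OF assms(2)])
  then show ?thesis
    using assms(1) unfolding compatible_def by simp (meson image_mono)
qed

section \<open>Generating functions and inclusion-exclusion\<close>

text \<open>These are the intersections that enter the inclusion-exclusion: the coordinates in
  \<open>I\<close> are compatible and the others are unrestricted. All decompositions are obtained
  for \<open>I = {}\<close>.\<close>

definition compatible_decs :: "nat set \<Rightarrow> (nat \<Rightarrow> real) \<Rightarrow> (nat \<Rightarrow> real) \<Rightarrow> (nat \<Rightarrow> real) set set set" where
  "compatible_decs I a b = {S. decomposes a b S \<and> (\<forall>i\<in>I. compatible i a b S)}"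

lemma decs_affine_map:
  assumes "S \<in> compatible_decs I a b" "\<And>l. \<beta> l > 0"
  shows "(`) (affine_map \<alpha> \<beta>) ` S \<in> compatible_decs I (affine_ends \<alpha> \<beta> a) (affine_ends \<alpha> \<beta> b)"
  using assms by (auto simp: compatible_decs_def intro: dec_affine_map compatible_affine_map)

lemma decs_extensional: "S \<in> compatible_decs I a b \<Longrightarrow> R \<in> S \<Longrightarrow> R \<subseteq> extensional {1..d}"
  using dec_mem(1)[of a b S R] mem_rect by (auto simp: compatible_decs_def)

text \<open>The inequality at every index makes all scale factors positive, so the affine map has a
  coordinatewise inverse. Boxes cut out of the unit cube satisfy it by
  \<open>lower_less_upper\<close>.\<close>

lemma decs_bij:
  assumes "\<And>l. a l < b l"
  shows "bij_betw (\<lambda>S. (`) (affine_map a (\<lambda>l. b l - a l)) ` S) (compatible_decs I (\<lambda>_. 0) (\<lambda>_. 1)) (compatible_decs I a b)"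
proof -
  define \<beta> where "\<beta> = (\<lambda>l. b l - a l)"
  have \<beta>: "\<beta> l > 0" for l using assms by (simp add: \<beta>_def)
  define f where "f = (\<lambda>S. (`) (affine_map a \<beta>) ` S)"
  define g where "g = (\<lambda>S. (`) (affine_map (\<lambda>l. - (a l / \<beta> l)) (\<lambda>l. 1 / \<beta> l)) ` S)"
  have affine_ends: "affine_ends a \<beta> (\<lambda>_. 0) = a" "affine_ends a \<beta> (\<lambda>_. 1) = b"
    by (auto simp: affine_ends_def \<beta>_def)
  have sc': "affine_ends (\<lambda>l. - (a l / \<beta> l)) (\<lambda>l. 1 / \<beta> l) a = (\<lambda>_. 0)"
       "affine_ends (\<lambda>l. - (a l / \<beta> l)) (\<lambda>l. 1 / \<beta> l) b = (\<lambda>_. 1)"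
    using affine_ends_inverse[of \<beta> a "\<lambda>_. 0", OF \<beta>] affine_ends_inverse[of \<beta> a "\<lambda>_. 1", OF \<beta>]
    by (simp_all only: affine_ends)
  have id: "(`) u ` ((`) v ` S) = S" if "\<And>R x. R \<in> S \<Longrightarrow> x \<in> R \<Longrightarrow> u (v x) = x"
    for S :: "(nat \<Rightarrow> real) set set" and u v
  proof -
    have "u ` (v ` R) = R" if "R \<in> S" for R
      unfolding image_image using \<open>\<And>R x. R \<in> S \<Longrightarrow> x \<in> R \<Longrightarrow> u (v x) = x\<close>[OF that] by simp
    then show ?thesis unfolding image_image by simp
  qed
  have "bij_betw f (compatible_decs I (\<lambda>_. 0) (\<lambda>_. 1)) (compatible_decs I a b)"
  proof (rule bij_betw_byWitness[of _ g])
    show "\<forall>S\<in>compatible_decs I (\<lambda>_. 0) (\<lambda>_. 1). g (f S) = S"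
      unfolding f_def g_def by (intro ballI id affine_map_inverse(1) \<beta>) (use decs_extensional in blast)
    show "\<forall>S\<in>compatible_decs I a b. f (g S) = S"
      unfolding f_def g_def by (intro ballI id affine_map_inverse(2) \<beta>) (use decs_extensional in blast)
    show "f ` compatible_decs I (\<lambda>_. 0) (\<lambda>_. 1) \<subseteq> compatible_decs I a b"
      using decs_affine_map[of _ I "\<lambda>_. 0" "\<lambda>_. 1" \<beta> a] \<beta> by (auto simp: f_def affine_ends)
    show "g ` compatible_decs I a b \<subseteq> compatible_decs I (\<lambda>_. 0) (\<lambda>_. 1)"
      using decs_affine_map[of _ I a b "\<lambda>l. 1 / \<beta> l" "\<lambda>l. - (a l / \<beta> l)"] \<beta> by (auto simp: g_def sc')
  qed
  then show ?thesis by (simp only: f_def \<beta>_def)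
qed

lemma card_affine_map_image:
  assumes "\<And>l. \<beta> l > 0" "S \<in> compatible_decs I a b"
  shows "card ((`) (affine_map \<alpha> \<beta>) ` S) = card S"
proof (rule card_image, rule inj_onI)
  fix R R' assume R: "R \<in> S" "R' \<in> S" "affine_map \<alpha> \<beta> ` R = affine_map \<alpha> \<beta> ` R'"
  have "inj_on (affine_map \<alpha> \<beta>) (extensional {1..d})"
    by (rule inj_on_inverseI, rule affine_map_inverse(1)) (use assms(1) in auto)
  from inj_on_image_eq_iff[OF this decs_extensional[OF assms(2) R(1)] decs_extensional[OF assms(2) R(2)]]
  show "R = R'" using R(3) by simp
qed

lemma weight_gf_decs:
  assumes "\<And>l. a l < b l"
  shows "weight_gf card (compatible_decs I a b) = weight_gf card (compatible_decs I (\<lambda>_. 0) (\<lambda>_. 1))"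
  by (rule weight_gf_bij[OF decs_bij[OF assms], symmetric]) (simp add: card_affine_map_image assms)

lemma finite_level_decs:
  assumes "\<And>l. a l < b l"
  shows "finite {S\<in>compatible_decs I a b. card S = n}"
proof -
  have "finite {S\<in>compatible_decs I (\<lambda>_. 0) (\<lambda>_. 1). card S = n}"
    by (rule finite_subset[OF _ finite_decompositions[OF p2, of d n]])
      (auto simp: decomposition_iff compatible_decs_def)
  moreover have "bij_betw (\<lambda>S. (`) (affine_map a (\<lambda>l. b l - a l)) ` S)
      {S\<in>compatible_decs I (\<lambda>_. 0) (\<lambda>_. 1). card S = n} {S\<in>compatible_decs I a b. card S = n}"
    by (rule bij_betw_level[OF decs_bij[OF assms]]) (simp add: card_affine_map_image assms)
  ultimately show ?thesis
    using bij_betw_finite by blast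
qed

lemma lower_less_upper:
  assumes "\<And>l. a l < b l" "j \<in> {1..p}"
  shows "lower a b i j l < upper a b i j l"
  using assms cut_point_strict_mono[of a i b "j - 1" j] by (auto simp: lower_def upper_def)

text \<open>Surjectivity is \<open>dec_compatible_imp_node\<close>, with the conditions in
  \<open>I\<close> passed to the cells by \<open>compatible_cell\<close>. For injectivity, the
  component \<open>f j\<close> is recovered from the union as the set of rectangles inside the
  \<open>j\<close>-th cell.\<close>

lemma decs_insert_bij:
  assumes "\<And>l. a l < b l" "i \<in> {1..d}" "I \<subseteq> {1..d}" "i \<notin> I"
  shows "bij_betw (\<lambda>f. \<Union>j\<in>{1..p}. f j) (\<Pi>\<^sub>E j\<in>{1..p}. compatible_decs I (lower a b i j) (upper a b i j)) (compatible_decs (insert i I) a b)"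
proof -
  have pr: "proper a b" using assms(1) by simp
  have cell_eq: "f j = {R\<in>(\<Union>j\<in>{1..p}. f j). R \<subseteq> cell a b i j}"
    if f: "f \<in> (\<Pi>\<^sub>E j\<in>{1..p}. compatible_decs I (lower a b i j) (upper a b i j))" and j: "j \<in> {1..p}" for f j
  proof -
    have D: "decomposes (lower a b i k) (upper a b i k) (f k)" if "k \<in> {1..p}" for k
      using f that by (auto simp: compatible_decs_def PiE_iff)
    have "R \<in> f j" if "k \<in> {1..p}" "R \<in> f k" "R \<subseteq> cell a b i j" for R k
      using cell_unique[OF pr assms(2) j that(1) dec_mem(2)[OF D[OF that(1)] that(2)] that(3)
          dec_cell_mem[OF D[OF that(1)] that(2)]] that by simp
    moreover have "R \<subseteq> cell a b i j" if "R \<in> f j" for R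
      using dec_cell_mem[OF D[OF j] that] .
    ultimately show ?thesis using j by blast
  qed
  show ?thesis
    unfolding bij_betw_def
  proof (intro conjI inj_onI equalityI subsetI)
    fix f g assume f: "f \<in> (\<Pi>\<^sub>E j\<in>{1..p}. compatible_decs I (lower a b i j) (upper a b i j))"
      and g: "g \<in> (\<Pi>\<^sub>E j\<in>{1..p}. compatible_decs I (lower a b i j) (upper a b i j))"
      and eq: "(\<Union>j\<in>{1..p}. f j) = (\<Union>j\<in>{1..p}. g j)"
    show "f = g"
      by (rule PiE_ext[OF f g]) (use cell_eq[OF f] cell_eq[OF g] eq in metis)
  next
    fix S assume "S \<in> (\<lambda>f. \<Union>j\<in>{1..p}. f j) ` (\<Pi>\<^sub>E j\<in>{1..p}. compatible_decs I (lower a b i j) (upper a b i j))"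
    then obtain f where S: "S = (\<Union>j\<in>{1..p}. f j)"
      and f: "\<And>j. j \<in> {1..p} \<Longrightarrow> f j \<in> compatible_decs I (lower a b i j) (upper a b i j)"
      by (auto simp only: PiE_iff)
    have D: "decomposes (lower a b i j) (upper a b i j) (f j)" if "j \<in> {1..p}" for j
      using f[OF that] by (simp add: compatible_decs_def)
    have "compatible i' a b S" if "i' \<in> I" for i'
    proof -
      have i': "i' \<in> {1..d}" "i \<noteq> i'" using that assms(3,4) by auto
      have "compatible i' a b (f j)" if "j \<in> {1..p}" for j
        using compatible_cell[OF pr assms(2) that i' D[OF that]] f[OF that] \<open>i' \<in> I\<close>
        by (simp add: compatible_decs_def)
      then show ?thesis unfolding S compatible_def by blast
    qed
    moreover have "compatible i a b S" unfolding S by (rule compatible_node[OF D])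
    moreover have "decomposes a b S" unfolding S by (rule decomposes.node[OF pr assms(2) D])
    ultimately show "S \<in> compatible_decs (insert i I) a b" by (simp add: compatible_decs_def)
  next
    fix S assume S: "S \<in> compatible_decs (insert i I) a b"
    then have "decomposes a b S" "compatible i a b S" by (auto simp: compatible_decs_def)
    from dec_compatible_imp_node[OF this(1) assms(2) this(2)]
    obtain f where f: "\<And>j. j \<in> {1..p} \<Longrightarrow> decomposes (lower a b i j) (upper a b i j) (f j)"
        and Sf: "S = (\<Union>j\<in>{1..p}. f j)"
      by blast
    have "f j \<in> compatible_decs I (lower a b i j) (upper a b i j)" if j: "j \<in> {1..p}" for j
    proof -
      have "compatible i' (lower a b i j) (upper a b i j) (f j)" if "i' \<in> I" for i'
      proof -
        have i': "i' \<in> {1..d}" "i \<noteq> i'" using that assms(3,4) by auto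
        have "compatible i' a b S" using S that by (simp add: compatible_decs_def)
        then have "compatible i' a b (f j)" unfolding Sf compatible_def using j by blast
        then show ?thesis
          using compatible_cell[OF pr assms(2) j i' f[OF j]] by simp
      qed
      then show ?thesis using f[OF j] by (simp add: compatible_decs_def)
    qed
    then have "restrict f {1..p} \<in> (\<Pi>\<^sub>E j\<in>{1..p}. compatible_decs I (lower a b i j) (upper a b i j))" by simp
    moreover have "S = (\<Union>j\<in>{1..p}. restrict f {1..p} j)" unfolding Sf by simp
    ultimately show "S \<in> (\<lambda>f. \<Union>j\<in>{1..p}. f j) ` (\<Pi>\<^sub>E j\<in>{1..p}. compatible_decs I (lower a b i j) (upper a b i j))"
      by (rule rev_image_eqI[where f = "\<lambda>f. \<Union>j\<in>{1..p}. f j"])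
  qed
qed

text \<open>Families in different cells are disjoint, so cardinalities add and generating functions
  multiply; by affine invariance all \<open>p\<close> factors are equal.\<close>

lemma weight_gf_decs_insert:
  assumes "i \<in> {1..d}" "I \<subseteq> {1..d}" "i \<notin> I"
  shows "weight_gf card (compatible_decs (insert i I) (\<lambda>_. 0) (\<lambda>_. 1)) = (weight_gf card (compatible_decs I (\<lambda>_. 0) (\<lambda>_. 1)) ^ p :: 'a :: comm_semiring_1 fps)"
proof -
  let ?a = "\<lambda>_::nat. 0::real" and ?b = "\<lambda>_::nat. 1::real"
  have l: "lower ?a ?b i j l < upper ?a ?b i j l" if "j \<in> {1..p}" for j l
    using that by (intro lower_less_upper) auto
  have "weight_gf card (compatible_decs (insert i I) ?a ?b) =
      (weight_gf (\<lambda>f. \<Sum>j\<in>{1..p}. card (f j)) (\<Pi>\<^sub>E j\<in>{1..p}. compatible_decs I (lower ?a ?b i j) (upper ?a ?b i j)) :: 'a fps)"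
  proof (rule weight_gf_bij[symmetric, OF decs_insert_bij])
    fix f assume "f \<in> (\<Pi>\<^sub>E j\<in>{1..p}. compatible_decs I (lower ?a ?b i j) (upper ?a ?b i j))"
    then have D: "decomposes (lower ?a ?b i j) (upper ?a ?b i j) (f j)" if "j \<in> {1..p}" for j
      using that by (auto simp: compatible_decs_def PiE_iff)
    have "f j \<inter> f k = {}" if "j \<in> {1..p}" "k \<in> {1..p}" "j \<noteq> k" for j k
      using dec_cells_disjoint[OF _ assms(1) that D[OF that(1)] D[OF that(2)]]
        dec_mem(2)[OF D[OF that(1)]] by fastforce
    then show "card (\<Union>j\<in>{1..p}. f j) = (\<Sum>j\<in>{1..p}. card (f j))"
      using dec_finite[OF D] by (intro card_UN_disjoint) auto
  qed (use assms in auto)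
  also have "\<dots> = (\<Prod>j\<in>{1..p}. weight_gf card (compatible_decs I (lower ?a ?b i j) (upper ?a ?b i j)))"
    by (intro weight_gf_PiE finite_level_decs l) auto
  also have "\<dots> = (\<Prod>j\<in>{1..p}. weight_gf card (compatible_decs I ?a ?b))"
    by (intro prod.cong refl weight_gf_decs l)
  finally show ?thesis by simp
qed

lemma weight_gf_decs_power:
  assumes "I \<subseteq> {1..d}"
  shows "weight_gf card (compatible_decs I (\<lambda>_. 0) (\<lambda>_. 1)) = (weight_gf card (compatible_decs {} (\<lambda>_. 0) (\<lambda>_. 1)) ^ (p ^ card I) :: 'a :: comm_semiring_1 fps)"
proof -
  have "finite I" using assms finite_subset by blast
  then show ?thesis
    using assms
  proof (induction I rule: finite_induct)
    case (insert i I)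
    then show ?case by (simp add: weight_gf_decs_insert mult.commute flip: power_mult)
  qed simp
qed

text \<open>The outermost splitting of a tree gives a compatible coordinate, while an undivided box
  fits into none of its cells.\<close>

lemma no_compatible_iff:
  assumes "decomposes a b S"
  shows "(\<forall>i\<in>{1..d}. \<not> compatible i a b S) \<longleftrightarrow> S = {rect d a b}"
proof
  assume "\<forall>i\<in>{1..d}. \<not> compatible i a b S"
  with assms show "S = {rect d a b}"
    by cases (use compatible_node in blast)+
next
  assume S: "S = {rect d a b}"
  show "\<forall>i\<in>{1..d}. \<not> compatible i a b S"
    using rect_not_subset_cell[OF dec_proper[OF assms]] by (auto simp: compatible_def S)
qed

text \<open>After exchanging the sums, each decomposition \<open>S\<close> carries the alternating
  sum over the subsets of its set \<open>c S\<close> of compatible coordinates. Only the undivided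
  cube, of cardinality 1, survives, which gives \<open>fps_X\<close>. On the other side, the term
  for \<open>I\<close> depends only on \<open>card I\<close> by
  \<open>weight_gf_decs_power\<close>.\<close>

theorem decompositions_fps_equation:
  fixes F :: "'a :: comm_ring_1 fps"
  defines "F \<equiv> Abs_fps (\<lambda>n. of_nat (num_decompositions d p n))"
  shows "(\<Sum>k=0..d. (-1) ^ k * of_nat (d choose k) * F ^ (p ^ k)) = fps_X"
proof -
  let ?a = "\<lambda>_::nat. 0::real" and ?b = "\<lambda>_::nat. 1::real"
  have F: "F = weight_gf card (compatible_decs {} ?a ?b)"
    by (rule fps_ext) (simp add: F_def weight_gf_nth num_decompositions_def decomposition_iff compatible_decs_def)
  have "(\<Sum>I\<in>Pow {1..d}. (-1) ^ card I * weight_gf card (compatible_decs I ?a ?b)) = (fps_X :: 'a fps)"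
  proof (rule fps_ext)
    fix n
    define D where "D = {S\<in>compatible_decs {} ?a ?b. card S = n}"
    define c where "c = (\<lambda>S. {i\<in>{1..d}. compatible i ?a ?b S})"
    have fin: "finite D" unfolding D_def by (rule finite_level_decs) simp
    have "fps_nth ((-1) ^ card I * weight_gf card (compatible_decs I ?a ?b)) n =
        (\<Sum>S\<in>D. if I \<subseteq> c S then (-1) ^ card I else (0::'a))" if "I \<in> Pow {1..d}" for I
    proof -
      have "fps_nth ((-1) ^ card I * weight_gf card (compatible_decs I ?a ?b)) n =
         (-1) ^ card I * (of_nat (card {S\<in>compatible_decs I ?a ?b. card S = n}) :: 'a)"
        by (cases "even (card I)") (simp_all add: weight_gf_nth)
      also have "{S\<in>compatible_decs I ?a ?b. card S = n} = {S\<in>D. I \<subseteq> c S}"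
        using that by (auto simp: D_def compatible_decs_def c_def)
      also have "(-1) ^ card I * of_nat (card {S\<in>D. I \<subseteq> c S}) = (\<Sum>S\<in>{S\<in>D. I \<subseteq> c S}. (-1) ^ card I :: 'a)"
        by (simp add: mult.commute)
      also have "\<dots> = (\<Sum>S\<in>D. if I \<subseteq> c S then (-1) ^ card I else 0)"
        by (rule sum.inter_filter[OF fin])
      finally show ?thesis .
    qed
    then have "fps_nth (\<Sum>I\<in>Pow {1..d}. (-1) ^ card I * weight_gf card (compatible_decs I ?a ?b)) n =
        (\<Sum>I\<in>Pow {1..d}. \<Sum>S\<in>D. if I \<subseteq> c S then (-1) ^ card I else (0::'a))"
      unfolding fps_sum_nth by (intro sum.cong refl)
    also have "\<dots> = (\<Sum>S\<in>D. \<Sum>I\<in>Pow {1..d}. if I \<subseteq> c S then (-1) ^ card I else 0)"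
      by (rule sum.swap)
    also have "\<dots> = (\<Sum>S\<in>D. \<Sum>I\<in>Pow (c S). (-1) ^ card I)"
    proof (rule sum.cong[OF refl])
      fix S
      have "Pow (c S) = {I\<in>Pow {1..d}. I \<subseteq> c S}" by (auto simp: c_def)
      then show "(\<Sum>I\<in>Pow {1..d}. if I \<subseteq> c S then (-1) ^ card I else 0) = (\<Sum>I\<in>Pow (c S). (-1) ^ card I :: 'a)"
        by (simp only: sum.inter_filter[OF finite_Pow_iff[THEN iffD2, OF finite_atLeastAtMost]])
    qed
    also have "\<dots> = (\<Sum>S\<in>D. if S = {rect d ?a ?b} then 1 else 0)"
    proof (rule sum.cong[OF refl])
      fix S assume "S \<in> D"
      then have "c S = {} \<longleftrightarrow> S = {rect d ?a ?b}"
        using no_compatible_iff[of ?a ?b S] by (auto simp: D_def compatible_decs_def c_def)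
      moreover have "finite (c S)" by (simp add: c_def)
      ultimately show "(\<Sum>I\<in>Pow (c S). (-1) ^ card I) = (if S = {rect d ?a ?b} then 1 else 0 :: 'a)"
        by (simp add: sum_Pow_alternating)
    qed
    also have "\<dots> = (if {rect d ?a ?b} \<in> D then 1 else 0)"
      using fin by simp
    also have "{rect d ?a ?b} \<in> D \<longleftrightarrow> n = 1"
      using decomposes.leaf[of ?a ?b] by (auto simp: D_def compatible_decs_def)
    finally show "fps_nth (\<Sum>I\<in>Pow {1..d}. (-1) ^ card I * weight_gf card (compatible_decs I ?a ?b)) n = fps_nth (fps_X :: 'a fps) n"
      by simp
  qed
  moreover have "(\<Sum>I\<in>Pow {1..d}. (-1) ^ card I * weight_gf card (compatible_decs I ?a ?b)) =
      (\<Sum>I\<in>Pow {1..d}. (-1) ^ card I * F ^ (p ^ card I) :: 'a fps)"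
    unfolding F by (rule sum.cong[OF refl], subst weight_gf_decs_power) auto
  ultimately show ?thesis
    using sum_Pow_card[of "{1..d}" "\<lambda>k. (-1) ^ k * F ^ (p ^ k)"] by (simp add: algebra_simps)
qed

end

section \<open>Asymptotics of the coefficients\<close>

locale positive_splits = splits +
  assumes d1: "d \<ge> 1"
begin

section \<open>The polynomial \<open>Q\<close> and its dominant linear term\<close>

text \<open>This is \<open>(p ^ k - 1) / (p - 1)\<close>, written without division.\<close>

definition geo :: "nat \<Rightarrow> nat" where
  "geo k = (\<Sum>i<k. p ^ i)"

lemma geo_0 [simp]: "geo 0 = 0" and geo_1 [simp]: "geo (Suc 0) = 1"
  and geo_Suc: "geo (Suc k) = geo k + p ^ k"
  by (simp_all add: geo_def)

lemma power_eq_geo: "p ^ k = Suc ((p - 1) * geo k)"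
proof (induction k)
  case (Suc k)
  have "Suc ((p - 1) * geo (Suc k)) = p ^ k + (p - 1) * p ^ k"
    using Suc by (simp add: geo_Suc algebra_simps)
  also have "\<dots> = p ^ Suc k" using p2 by (simp add: algebra_simps flip: power_Suc)
  finally show ?case by simp
qed simp

lemma geo_ge: "2 ^ k \<le> geo k + 1"
proof (induction k)
  case (Suc k)
  then show ?case using power_mono[OF p2, of k] by (simp add: geo_Suc)
qed simp

lemma power_le_geo: "k > 0 \<Longrightarrow> p ^ k \<le> p * geo k"
  by (cases k) (simp_all add: geo_Suc)

text \<open>The polymorphic type allows evaluation at the real radius as well as on the complex
  circle.\<close>

definition Q :: "'a :: real_normed_field \<Rightarrow> 'a" where
  "Q w = (\<Sum>k=0..d. (-1) ^ k * of_nat (d choose k) * w ^ geo k)"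

text \<open>The constant \<open>4 / 3\<close> is a compromise: with it \<open>P r\<^sub>0\<close> is already negative, while the bound
  in \<open>term_bound\<close> still holds (with equality for \<open>d = p = k = 2\<close>, \<open>r = r\<^sub>0\<close>).\<close>

definition r\<^sub>0 :: real where
  "r\<^sub>0 = 4 / (3 * real d * real p)"

lemma r0_pos: "r\<^sub>0 > 0" using d1 p2 by (simp add: r\<^sub>0_def)

text \<open>The weight \<open>(geo k)^2\<close> is the loss in
  \<open>one_minus_cos_of_nat_mult_le\<close>. The factors \<open>(1 / 2) ^ (k - 1)\<close> sum to
  less than 1, so all these terms together stay below the linear one. The tight case
  \<open>k = 2\<close> is treated separately.\<close>

lemma term_bound:
  assumes "2 \<le> k" "k \<le> d" "0 \<le> r" "r \<le> r\<^sub>0"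
  shows "real (d choose k) * (real (geo k))\<^sup>2 * r ^ geo k \<le> real d * r * (1 / 2) ^ (k - 1)"
proof -
  have dp: "real d \<ge> 2" "real p \<ge> 2" using assms p2 by auto
  have drp: "real d * r \<le> 4 / (3 * real p)"
  proof -
    have "real d * r \<le> real d * r\<^sub>0" using assms by (intro mult_left_mono) auto
    then show ?thesis using dp by (simp add: r\<^sub>0_def)
  qed
  also have "4 / (3 * real p) \<le> 2 / 3" using dp by (simp add: field_simps)
  finally have dr: "real d * r \<le> 2 / 3" .
  have ge: "geo k \<ge> 1" using geo_ge[of k] power_increasing[of 2 k "2::nat"] assms by simp
  have "real (d choose k) * (real (geo k))\<^sup>2 * r ^ (geo k - 1) \<le> real d * (1 / 2) ^ (k - 1)"
  proof (cases "k = 2")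
    case True
    have g2: "geo 2 = p + 1" by (simp add: numeral_2_eq_2 geo_Suc)
    have ch2: "real (d choose 2) = real d * (real d - 1) / 2"
    proof -
      have "2 * (d choose 2) = d * (d - 1)"
        by (cases d) (simp_all add: choose_two)
      then have "2 * real (d choose 2) = real (d * (d - 1))" by (metis of_nat_mult of_nat_numeral)
      then show ?thesis using d1 by (simp add: of_nat_diff)
    qed
    \<comment> \<open>For \<open>p = 2\<close> the worst radius \<open>r\<^sub>0\<close> reduces
      this to \<open>(d - 2)^2 \<ge> 0\<close>. For \<open>p \<ge> 3\<close> the estimates
      \<open>p + 1 \<le> 4 p / 3\<close> and \<open>r ^ p \<le> r ^ 3\<close> leave
      \<open>64 / 81 * d * r\<close>.\<close>
    have "(real d - 1) * (real p + 1)\<^sup>2 * r ^ p \<le> 1"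
    proof (cases "p = 2")
      case True
      have "(real d - 1) * (9 * r\<^sup>2) \<le> (real d - 1) * (9 * r\<^sub>0\<^sup>2)"
        using assms dp by (intro mult_left_mono power_mono) auto
      also have "\<dots> = 4 * (real d - 1) / (real d)\<^sup>2"
        unfolding r\<^sub>0_def using dp True by (simp add: power2_eq_square field_simps)
      also have "\<dots> \<le> 1"
        using dp sum_squares_bound[of "real d" 2] by (simp add: field_simps power2_eq_square)
      finally show ?thesis using True by (simp add: algebra_simps)
    next
      case False
      then have p3: "p \<ge> 3" using p2 by simp
      have r: "r \<le> 2 / (3 * real p)"
      proof -
        have "r\<^sub>0 \<le> 4 / (3 * 2 * real p)"
          unfolding r\<^sub>0_def using dp by (intro divide_left_mono mult_right_mono mult_left_mono) auto
        then show ?thesis using assms by (simp add: field_simps)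
      qed
      have "2 / (3 * real p) \<le> 1" using p3 by (simp add: field_simps)
      with r have "r \<le> 1" by linarith
      have "r ^ p = r * r ^ (p - 1)" using p2 by (simp flip: power_Suc)
      also have "\<dots> \<le> r * r\<^sup>2"
        using assms p3 \<open>r \<le> 1\<close> by (intro mult_left_mono power_decreasing) auto
      also have "\<dots> \<le> r * (2 / (3 * real p))\<^sup>2"
        using assms r by (intro mult_left_mono power_mono) auto
      finally have rp: "r ^ p \<le> r * (2 / (3 * real p))\<^sup>2" .
      have "(real p + 1)\<^sup>2 \<le> (4 / 3 * real p)\<^sup>2"
        using p3 by (intro power_mono) auto
      then have "(real d - 1) * (real p + 1)\<^sup>2 * r ^ p \<le> real d * (4 / 3 * real p)\<^sup>2 * (r * (2 / (3 * real p))\<^sup>2)"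
        using assms dp rp by (intro mult_mono) auto
      also have "\<dots> = real d * r * (64 / 81)"
        using p3 by (simp add: power2_eq_square field_simps)
      also have "\<dots> \<le> 1" using dr by simp
      finally show ?thesis .
    qed
    then have "real d / 2 * ((real d - 1) * (real p + 1)\<^sup>2 * r ^ p) \<le> real d / 2 * 1"
      by (intro mult_left_mono) auto
    moreover have "real (d choose 2) * (real (geo 2))\<^sup>2 * r ^ (geo 2 - 1) =
        real d / 2 * ((real d - 1) * (real p + 1)\<^sup>2 * r ^ p)"
      by (simp add: g2 ch2 add.commute)
    ultimately show ?thesis using True by simp
  next
    case False
    then have k3: "k \<ge> 3" and d3: "real d \<ge> 3" using assms by auto
    \<comment> \<open>The power \<open>r ^ (geo k - 1)\<close> is split as
      \<open>r ^ (k - 1) * r ^ j\<close>. The first factor pairs with the binomial coefficient to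
      give \<open>(d r) ^ (k - 1)\<close>; the second, at most \<open>(2 / 9) ^ j\<close>, absorbs
      \<open>(geo k)^2\<close> and the excess \<open>(4 / 3) ^ k\<close>, because
      \<open>k \<le> j\<close>.\<close>
    define j where "j = geo k - k"
    have "2 * k + 1 \<le> 2 ^ k"
      using k3 by (induction k rule: dec_induct) auto
    then have kj: "2 * k \<le> geo k" using geo_ge[of k] by simp
    then have j: "geo k = j + k" "k \<le> j" by (auto simp: j_def)
    have r: "r \<le> 2 / 9"
    proof -
      have "3 * r \<le> real d * r" using d3 assms by (intro mult_right_mono) auto
      with dr show ?thesis by simp
    qed
    have fact: "(fact k :: real) \<ge> 6"
    proof -
      have "(fact 3 :: real) \<le> fact k" using k3 by (intro fact_mono)
      then show ?thesis by (simp add: fact_numeral)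
    qed
    have "real ((d choose k) * fact k) \<le> real (d ^ k)"
      using binomial_fact_pow of_nat_le_iff by blast
    then have "real (d choose k) * 6 \<le> real d ^ k"
      using mult_left_mono[OF fact, of "real (d choose k)"] by simp
    then have ch: "real (d choose k) \<le> real d ^ k / 6" by simp
    have "(real (geo k))\<^sup>2 \<le> (2 * real j)\<^sup>2"
      using j by (intro power_mono) auto
    also have "\<dots> \<le> 8 * 2 ^ j"
    proof -
      have "j * j \<le> 2 * 2 ^ j"
      proof (cases "j < 4")
        case True
        then have "j = 0 \<or> j = 1 \<or> j = 2 \<or> j = 3" by auto
        then show ?thesis by auto
      next
        case False
        then have "4 \<le> j" by simp
        then have "j * j \<le> 2 ^ j"
        proof (induction j rule: dec_induct)
          case (step j)
          have "Suc j * Suc j \<le> 2 * (j * j)"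
          proof -
            have "4 * j \<le> j * j" using step by simp
            moreover have "Suc j * Suc j = j * j + 2 * j + 1" by simp
            ultimately show ?thesis using step(1) by linarith
          qed
          then show ?case using step by simp
        qed simp
        then show ?thesis by simp
      qed
      then have "real (j * j) \<le> real (2 * 2 ^ j)" using of_nat_le_iff by blast
      then show ?thesis by (simp add: power2_eq_square)
    qed
    finally have g: "(real (geo k))\<^sup>2 \<le> 8 * 2 ^ j" .
    have "r ^ (geo k - 1) = r ^ (k - 1) * r ^ j"
      using k3 j by (simp add: add.commute flip: power_add)
    also have "\<dots> \<le> r ^ (k - 1) * (2 / 9) ^ j"
      using assms r by (intro mult_left_mono power_mono) auto
    finally have rg: "r ^ (geo k - 1) \<le> r ^ (k - 1) * (2 / 9) ^ j" .
    have "real (d choose k) * (real (geo k))\<^sup>2 * r ^ (geo k - 1) \<le>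
        (real d ^ k / 6) * (8 * 2 ^ j) * (r ^ (k - 1) * (2 / 9) ^ j)"
      using ch g rg assms by (intro mult_mono) auto
    also have "\<dots> = real d * (real d * r) ^ (k - 1) * (4 / 3 * (4 / 9) ^ j)"
    proof -
      have "real d ^ k = real d * real d ^ (k - 1)" using k3 by (simp flip: power_Suc)
      moreover have "(4 / 9 :: real) ^ j = 2 ^ j * (2 / 9) ^ j"
        by (simp flip: power_mult_distrib)
      ultimately show ?thesis by (simp add: power_mult_distrib)
    qed
    also have "\<dots> \<le> real d * (2 / 3) ^ (k - 1) * (4 / 3 * (4 / 9) ^ j)"
      using dr assms by (intro mult_mono power_mono) auto
    also have "\<dots> = real d * (1 / 2) ^ (k - 1) * ((4 / 3) ^ (k - 1) * (4 / 3) * (4 / 9) ^ j)"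
    proof -
      have "(2 / 3 :: real) ^ (k - 1) = (1 / 2) ^ (k - 1) * (4 / 3) ^ (k - 1)"
        by (simp flip: power_mult_distrib)
      then show ?thesis by simp
    qed
    also have "\<dots> \<le> real d * (1 / 2) ^ (k - 1) * 1"
    proof (intro mult_left_mono)
      have "(4 / 3 :: real) ^ (k - 1) * (4 / 3) = (4 / 3) ^ k"
        by (rule power_minus_mult) (use k3 in simp)
      also have "\<dots> \<le> (4 / 3) ^ j" using j by (intro power_increasing) auto
      finally have "(4 / 3 :: real) ^ (k - 1) * (4 / 3) * (4 / 9) ^ j \<le> (4 / 3) ^ j * (4 / 9) ^ j"
        by (intro mult_right_mono) auto
      also have "\<dots> = (16 / 27) ^ j" by (simp flip: power_mult_distrib)
      also have "\<dots> \<le> 1" by (intro power_le_one) auto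
      finally show "(4 / 3 :: real) ^ (k - 1) * (4 / 3) * (4 / 9) ^ j \<le> 1" .
    qed auto
    finally show ?thesis by simp
  qed
  then have "r * (real (d choose k) * (real (geo k))\<^sup>2 * r ^ (geo k - 1)) \<le> r * (real d * (1 / 2) ^ (k - 1))"
    using assms by (intro mult_left_mono)
  moreover have "r ^ geo k = r * r ^ (geo k - 1)" using ge by (simp flip: power_Suc)
  ultimately show ?thesis by (simp add: algebra_simps)
qed

lemma sum_split: "(\<Sum>k=0..d. f k) = f 0 + f (Suc 0) + (\<Sum>k=2..d. (f k :: 'a :: comm_monoid_add))"
proof -
  have "(\<Sum>k=0..d. f k) = f 0 + (\<Sum>k=Suc 0..d. f k)"
    by (simp add: sum.atLeast_Suc_atMost)
  also have "(\<Sum>k=Suc 0..d. f k) = f (Suc 0) + (\<Sum>k=Suc (Suc 0)..d. f k)"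
    using d1 by (subst sum.atLeast_Suc_atMost) simp_all
  finally show ?thesis by (simp add: add.assoc numeral_2_eq_2)
qed

lemma sum_half_powers: "(\<Sum>k=2..d. (1 / 2 :: real) ^ (k - 1)) = 1 - (1 / 2) ^ (d - 1)"
  using d1
proof (induction d rule: dec_induct)
  case (step n)
  have "(1 / 2 :: real) ^ (n - 1) = 2 * (1 / 2) ^ n"
    using step by (cases n) auto
  then show ?case using step by simp
qed simp

lemma sum_quarter_powers: "(\<Sum>k=2..d. (1 / 4 :: real) ^ k) \<le> 1 / 12"
proof -
  have "(\<Sum>k=2..d. (1 / 4 :: real) ^ k) = (1 / 4 - (1 / 4) ^ d) / 3"
    using d1
  proof (induction d rule: dec_induct)
    case (step n)
    then have "(\<Sum>k=2..Suc n. (1 / 4 :: real) ^ k) = (1 / 4 - (1 / 4) ^ n) / 3 + (1 / 4) ^ Suc n"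
      by simp
    also have "\<dots> = (1 / 4 - (1 / 4) ^ Suc n) / 3"
      unfolding power_Suc by (simp only: diff_divide_distrib)
    finally show ?case .
  qed simp
  moreover have "(1 / 4 :: real) ^ d \<ge> 0" by simp
  moreover have "(1 / 4 - x) / 3 \<le> 1 / 12" if "x \<ge> 0" for x :: real
    using that by simp
  ultimately show ?thesis by metis
qed

lemma tail_bound:
  assumes "0 < r" "r \<le> r\<^sub>0"
  shows "(\<Sum>k=2..d. real (d choose k) * (real (geo k))\<^sup>2 * r ^ geo k) < real d * r"
proof -
  have "(\<Sum>k=2..d. real (d choose k) * (real (geo k))\<^sup>2 * r ^ geo k) \<le> (\<Sum>k=2..d. real d * r * (1 / 2) ^ (k - 1))"
    using assms by (intro sum_mono term_bound) auto
  also have "\<dots> = real d * r * (1 - (1 / 2) ^ (d - 1))"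
    by (simp only: sum_half_powers sum_distrib_left[symmetric])
  also have "\<dots> < real d * r * 1"
    using assms d1 by (intro mult_strict_left_mono) auto
  finally show ?thesis by simp
qed

lemma geo_ge3: "k \<ge> 2 \<Longrightarrow> real (geo k) \<ge> 3"
  using geo_ge[of k] power_increasing[of 2 k "2::nat"] by simp

lemma zero_power_geo: "k \<ge> 2 \<Longrightarrow> 0 ^ geo k = (0 :: 'a :: semiring_1)"
  using geo_ge3[of k] by (auto simp: power_0_left)

text \<open>The linear term is at most \<open>2 / 3\<close> in norm, and
  \<open>geo k \<ge> 3\<close> makes the sum of the later ones at most a ninth of
  \<open>d * r\<close>. Hence \<open>Q w\<close> has distance less than 1 from 1, and
  \<open>1 / Q\<close> is holomorphic in the disc.\<close>

lemma Re_Q_pos: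
  fixes w :: complex
  assumes "norm w \<le> r\<^sub>0"
  shows "Re (Q w) > 0"
proof (cases "w = 0")
  case True
  have "Q w = 1"
    unfolding Q_def sum_split using True by (simp add: zero_power_geo)
  then show ?thesis by simp
next
  case False
  define r where "r = norm w"
  have r: "0 < r" "r \<le> r\<^sub>0" using assms False by (auto simp: r_def)
  have "Q w - 1 = - of_nat d * w + (\<Sum>k=2..d. (-1) ^ k * of_nat (d choose k) * w ^ geo k)"
    unfolding Q_def sum_split by simp
  also have "norm \<dots> \<le> real d * r + (\<Sum>k=2..d. real (d choose k) * r ^ geo k)"
    by (intro norm_triangle_le add_mono sum_norm_le) (auto simp: r_def norm_mult norm_power)
  also have "(\<Sum>k=2..d. real (d choose k) * r ^ geo k) \<le>
     (\<Sum>k=2..d. 1 / 9 * (real (d choose k) * (real (geo k))\<^sup>2 * r ^ geo k))"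
  proof (rule sum_mono)
    fix k assume "k \<in> {2..d}"
    then have "3\<^sup>2 \<le> (real (geo k))\<^sup>2" using geo_ge3[of k] by (intro power_mono) auto
    then have "(real (d choose k) * r ^ geo k) * 9 \<le> (real (d choose k) * r ^ geo k) * (real (geo k))\<^sup>2"
      using r by (intro mult_left_mono) auto
    then show "real (d choose k) * r ^ geo k \<le> 1 / 9 * (real (d choose k) * (real (geo k))\<^sup>2 * r ^ geo k)"
      by (simp add: algebra_simps)
  qed
  also have "\<dots> \<le> 1 / 9 * (real d * r)"
    unfolding sum_distrib_left[symmetric] using tail_bound[OF r] by (intro mult_left_mono) auto
  also have "real d * r + 1 / 9 * (real d * r) < 1"
  proof -
    have "real d * r \<le> real d * r\<^sub>0" using r by (intro mult_left_mono) auto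
    also have "\<dots> = 4 / (3 * real p)" using d1 by (simp add: r\<^sub>0_def)
    also have "\<dots> \<le> 2 / 3" using p2 by (simp add: field_simps)
    finally show ?thesis by linarith
  qed
  finally have "norm (Q w - 1) < 1" by simp
  then have "\<bar>Re (Q w - 1)\<bar> < 1" using abs_Re_le_cmod le_less_trans by blast
  then show ?thesis by simp
qed

text \<open>This is the coefficient of \<open>1 - cos t\<close> in the lower bound
  \<open>Re_Q_ge\<close>.\<close>

definition \<kappa> :: "real \<Rightarrow> real" where
  "\<kappa> r = real d * r - (\<Sum>k=2..d. real (d choose k) * (real (geo k))\<^sup>2 * r ^ geo k)"

lemma kappa_pos: "0 < r \<Longrightarrow> r \<le> r\<^sub>0 \<Longrightarrow> \<kappa> r > 0"
  using tail_bound by (simp add: \<kappa>_def)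

text \<open>The linear term contributes exactly \<open>d r (1 - cos t)\<close>. Whatever its sign,
  the term with index \<open>k\<close> takes away at most \<open>(geo k)^2 (1 - cos t)\<close> times
  its size.\<close>

lemma Re_Q_ge:
  assumes "0 < r"
  shows "Re (Q (of_real r * iexp t)) \<ge> Q r + \<kappa> r * (1 - cos t)"
proof -
  have pow: "Re ((of_real r * iexp t) ^ n) = r ^ n * cos (of_nat n * t)" for n
  proof -
    have "(of_real r * iexp t) ^ n = of_real (r ^ n) * iexp (of_nat n * t)"
      by (simp add: power_mult_distrib exp_of_nat_mult[symmetric] algebra_simps)
    then show ?thesis by (simp add: Re_exp)
  qed
  have Re_term: "Re ((-1) ^ k * of_nat c * z) = (-1) ^ k * real c * Re z" for k c z
    by (cases "even k") auto
  have "Re (Q (of_real r * iexp t)) = (\<Sum>k=0..d. (-1) ^ k * real (d choose k) * (r ^ geo k * cos (geo k * t)))"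
    unfolding Q_def by (simp only: Re_sum Re_term pow)
  then have "Re (Q (of_real r * iexp t)) - Q r =
      (\<Sum>k=0..d. (-1) ^ k * real (d choose k) * (r ^ geo k * (cos (geo k * t) - 1)))"
    unfolding Q_def by (simp add: sum_subtractf[symmetric] algebra_simps)
  also have "\<dots> = real d * r * (1 - cos t) +
      (\<Sum>k=2..d. (-1) ^ k * real (d choose k) * (r ^ geo k * (cos (geo k * t) - 1)))"
    unfolding sum_split by (simp add: algebra_simps)
  finally have eq: "Re (Q (of_real r * iexp t)) - Q r = real d * r * (1 - cos t) +
      (\<Sum>k=2..d. (-1) ^ k * real (d choose k) * (r ^ geo k * (cos (geo k * t) - 1)))" .
  have "(\<Sum>k=2..d. - (real (d choose k) * (real (geo k))\<^sup>2 * r ^ geo k) * (1 - cos t)) \<le>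
      (\<Sum>k=2..d. (-1) ^ k * real (d choose k) * (r ^ geo k * (cos (geo k * t) - 1)))"
  proof (rule sum_mono)
    fix k assume "k \<in> {2..d}"
    have "0 \<le> 1 - cos (geo k * t)" by simp
    have "(real (d choose k) * r ^ geo k) * (1 - cos (geo k * t)) \<le>
        (real (d choose k) * r ^ geo k) * ((real (geo k))\<^sup>2 * (1 - cos t))"
      using one_minus_cos_of_nat_mult_le assms by (intro mult_left_mono) auto
    moreover have "\<bar>(-1) ^ k * real (d choose k) * (r ^ geo k * (cos (geo k * t) - 1))\<bar> =
        (real (d choose k) * r ^ geo k) * (1 - cos (geo k * t))"
      using assms by (simp add: abs_mult)
    ultimately show "- (real (d choose k) * (real (geo k))\<^sup>2 * r ^ geo k) * (1 - cos t) \<le>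
        (-1) ^ k * real (d choose k) * (r ^ geo k * (cos (geo k * t) - 1))"
      by (simp add: algebra_simps abs_le_iff)
  qed
  moreover have "(\<Sum>k=2..d. - (real (d choose k) * (real (geo k))\<^sup>2 * r ^ geo k) * (1 - cos t)) =
      (\<kappa> r - real d * r) * (1 - cos t)"
    unfolding sum_distrib_right[symmetric] by (simp add: \<kappa>_def sum_negf)
  ultimately show ?thesis using eq by (simp add: left_diff_distrib)
qed

text \<open>By \<open>deriv_q_poly\<close> below, \<open>q'(z) = P (z ^ (p - 1))\<close>.\<close>

definition P :: "real \<Rightarrow> real" where
  "P w = (\<Sum>k=0..d. (-1) ^ k * real (d choose k) * real (p ^ k) * w ^ geo k)"

section \<open>Location of the least critical point\<close>

lemma P_0: "P 0 = 1"
proof -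
  have "(\<Sum>k=2..d. (-1) ^ k * real (d choose k) * real (p ^ k) * 0 ^ geo k) = 0"
    by (simp add: zero_power_geo)
  then show ?thesis unfolding P_def sum_split by simp
qed

text \<open>The constant and linear terms add up to \<open>1 - 4 / 3\<close>. Since
  \<open>p ^ k \<le> p * geo k\<close> and \<open>geo k \<ge> 3 / 4 * 2 ^ k\<close>, the bound
  \<open>term_bound\<close> limits the others to \<open>32 / 9 * (1 / 4) ^ k\<close>, in total at
  most \<open>8 / 27 < 1 / 3\<close>.\<close>

lemma P_r0_neg: "P r\<^sub>0 < 0"
proof -
  have dpr: "real d * real p * r\<^sub>0 = 4 / 3" using d1 p2 by (simp add: r\<^sub>0_def)
  have "(\<Sum>k=2..d. (-1) ^ k * real (d choose k) * real (p ^ k) * r\<^sub>0 ^ geo k) \<le> (\<Sum>k=2..d. 32 / 9 * (1 / 4) ^ k)"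
  proof (rule sum_mono)
    fix k assume k: "k \<in> {2..d}"
    let ?T = "real (d choose k) * (real (geo k))\<^sup>2 * r\<^sub>0 ^ geo k"
    have g3: "real (geo k) \<ge> 3" using k geo_ge3 by simp
    have gk: "real (geo k) \<ge> 3 / 4 * 2 ^ k"
    proof -
      have "real (2 ^ k) \<le> real (geo k + 1)" using geo_ge of_nat_le_iff by blast
      then show ?thesis using g3 by simp
    qed
    have "(-1) ^ k * real (d choose k) * real (p ^ k) * r\<^sub>0 ^ geo k \<le> 1 * real (d choose k) * real (p ^ k) * r\<^sub>0 ^ geo k"
      using r0_pos by (intro mult_right_mono) (auto simp: minus_one_power_iff)
    also have "\<dots> \<le> 1 * real (d choose k) * (real p * real (geo k)) * r\<^sub>0 ^ geo k"
    proof -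
      have "p ^ k \<le> p * geo k" using k by (intro power_le_geo) auto
      then have "real (p ^ k) \<le> real (p * geo k)" by (rule of_nat_mono)
      then have "real (p ^ k) \<le> real p * real (geo k)" by simp
      then show ?thesis using r0_pos by (intro mult_right_mono mult_left_mono) auto
    qed
    also have "\<dots> = real p / real (geo k) * ?T"
      using g3 by (simp add: power2_eq_square field_simps)
    also have "\<dots> \<le> real p / (3 / 4 * 2 ^ k) * (real d * r\<^sub>0 * (1 / 2) ^ (k - 1))"
    proof (rule mult_mono)
      show "real p / real (geo k) \<le> real p / (3 / 4 * 2 ^ k)"
        using gk g3 by (intro divide_left_mono) auto
      show "?T \<le> real d * r\<^sub>0 * (1 / 2) ^ (k - 1)"
        using term_bound[of k r\<^sub>0] k r0_pos by simp
    qed (use r0_pos in auto)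
    also have "\<dots> = (real d * real p * r\<^sub>0) * (4 / 3) * ((1 / 2) ^ k * (1 / 2) ^ (k - 1))"
      by (simp add: field_simps)
    also have "(1 / 2 :: real) ^ (k - 1) = 2 * (1 / 2) ^ k"
      using k by (cases k) auto
    also have "(1 / 2 :: real) ^ k * (2 * (1 / 2) ^ k) = 2 * (1 / 4) ^ k"
      by (simp flip: power_mult_distrib)
    finally show "(-1) ^ k * real (d choose k) * real (p ^ k) * r\<^sub>0 ^ geo k \<le> 32 / 9 * (1 / 4) ^ k"
      by (simp add: dpr)
  qed
  also have "\<dots> = 32 / 9 * (\<Sum>k=2..d. (1 / 4) ^ k)" by (rule sum_distrib_left[symmetric])
  also have "\<dots> \<le> 32 / 9 * (1 / 12)" by (intro mult_left_mono sum_quarter_powers) auto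
  finally show ?thesis
    unfolding P_def sum_split using dpr by (simp add: algebra_simps)
qed

text \<open>The sign change from \<open>P_0\<close> to \<open>P_r0_neg\<close> gives a root, and the
  zero set in \<open>{0..r\<^sub>0}\<close> is compact, so it has a least element.\<close>

lemma ex_least_root: "\<exists>r. 0 < r \<and> r < r\<^sub>0 \<and> P r = 0 \<and> (\<forall>x>0. P x = 0 \<longrightarrow> r \<le> x)"
proof -
  have cont: "continuous_on A P" for A
    unfolding P_def by (intro continuous_intros)
  define Z where "Z = {x\<in>{0..r\<^sub>0}. P x = 0}"
  have "\<exists>x\<ge>0. x \<le> r\<^sub>0 \<and> P x = 0"
    using P_0 P_r0_neg r0_pos by (intro IVT2' cont) auto
  then have "Z \<noteq> {}" by (auto simp: Z_def)
  moreover have "closed Z"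
    unfolding Z_def by (rule continuous_closed_preimage_constant[OF cont closed_atLeastAtMost])
  moreover have "bounded Z"
    by (rule bounded_subset[of "{0..r\<^sub>0}"]) (auto simp: Z_def)
  ultimately obtain r where r: "r \<in> Z" "\<And>x. x \<in> Z \<Longrightarrow> r \<le> x"
    using compact_attains_inf[of Z] by (auto simp: compact_eq_bounded_closed)
  have "r \<noteq> 0" using r(1) P_0 by (auto simp: Z_def)
  moreover have "r \<noteq> r\<^sub>0" using r(1) P_r0_neg by (auto simp: Z_def)
  moreover have "r \<le> x" if "x > 0" "P x = 0" for x
    using r that by (cases "x \<le> r\<^sub>0") (auto simp: Z_def)
  ultimately show ?thesis using r by (intro exI[of _ r]) (auto simp: Z_def)
qed

section \<open>Saddle point analysis of the coefficients\<close>

definition Q_fps :: "complex fps" where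
  "Q_fps = (\<Sum>k=0..d. fps_const ((-1) ^ k * of_nat (d choose k)) * fps_X ^ geo k)"

lemma Q_fps_expansion: "Q has_fps_expansion Q_fps"
  unfolding Q_fps_def Q_def[abs_def]
  by (intro has_fps_expansion_sum has_fps_expansion_cmult_left has_fps_expansion_fps_X_power)

lemma Q_fps_0: "fps_nth Q_fps 0 = 1"
  unfolding Q_fps_def sum_split by (simp add: fps_sum_nth zero_power_geo power_0_left[symmetric])

lemma Q_holomorphic: "Q holomorphic_on A"
  unfolding Q_def by (intro holomorphic_intros)

lemma Q_nonzero: "norm w \<le> r\<^sub>0 \<Longrightarrow> Q (w::complex) \<noteq> 0"
  using Re_Q_pos[of w] by auto

lemma Q_of_real: "Q (of_real r :: complex) = of_real (Q r)"
  by (simp add: Q_def)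

lemma Q_real_pos:
  assumes "0 < r" "r \<le> r\<^sub>0" shows "Q (r::real) > 0"
  using Re_Q_pos[of "of_real r"] assms by (simp add: Q_of_real)

text \<open>On the circle of radius \<open>r\<close> the Cauchy integrand is
  \<open>\<phi> t * (G * L t) ^ m\<close> with \<open>L 0 = 1\<close>. The domination required by
  \<open>laplace_limit\<close> comes from \<open>Re_Q_ge\<close>, and \<open>P r = 0\<close> removes
  the linear term of \<open>L\<close> at 0, which leaves a Gaussian limit.\<close>

theorem coefficient_asymptotics:
  assumes r: "0 < r" "r < r\<^sub>0" and root: "P r = 0"
  defines "G \<equiv> 1 / (r * Q r ^ (p - 1))"
  obtains K where "K \<noteq> 0"
    "(\<lambda>m. of_real (sqrt m / G ^ m) * fps_nth (inverse Q_fps ^ (m * (p - 1) + 1)) m) \<longlonglongrightarrow> K"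
proof -
  define \<phi> where "\<phi> = (\<lambda>t. inverse (Q (of_real r * iexp t)))"
  define L where "L = (\<lambda>t. (of_real (Q r) * \<phi> t) ^ (p - 1) * inverse (iexp t))"
  \<comment> \<open>The 20 is the constant of \<open>one_minus_cos_ge\<close>; division by
    \<open>Q r\<close> normalises the bound at \<open>t = 0\<close>.\<close>
  define b where "b = \<kappa> r / (20 * Q r)"
  \<comment> \<open>The \<open>c k\<close> are the terms of \<open>Q r\<close> scaled to total 1.
    The \<open>\<nu> k\<close> are the exponents of \<open>q\<close> in the variable
    \<open>w = z ^ (p - 1)\<close>, so the mean of \<open>\<nu>\<close> with weights
    \<open>c\<close> is a multiple of \<open>P r\<close>.\<close>
  define c where "c = (\<lambda>k. (-1) ^ k * real (d choose k) * r ^ geo k / Q r)"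
  define \<nu> where "\<nu> = (\<lambda>k. real (p ^ k) / real (p - 1))"
  \<comment> \<open>Since \<open>M t\<close> is
    \<open>1 - t^2 * (\<Sum>k=0..d. c k * (\<nu> k)^2 / 2)\<close> to second order and
    \<open>L\<close> is its power with exponent \<open>- (p - 1)\<close>, this makes
    \<open>L t\<close> close to \<open>exp (- A * t^2)\<close>.\<close>
  define A where "A = - real (p - 1) * (\<Sum>k=0..d. c k * (\<nu> k)\<^sup>2 / 2)"
  have Qr: "Q r > 0" using Q_real_pos r by simp
  have b: "b > 0" using kappa_pos[of r] r Qr by (simp add: b_def)
  have norm_circ: "norm (of_real r * iexp t) = r" for t
    using r by (simp add: norm_mult)
  have Qnz: "Q (of_real r * iexp t) \<noteq> 0" for t
    by (rule Q_nonzero) (use r norm_circ in simp)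
  have contQ: "continuous_on B (\<lambda>t. Q (of_real r * iexp t))" for B
    unfolding Q_def by (intro continuous_intros)
  have cont\<phi>: "continuous_on {-pi..pi} \<phi>"
    unfolding \<phi>_def using Qnz by (intro continuous_intros contQ) auto
  have contL: "continuous_on {-pi..pi} L"
    unfolding L_def by (intro continuous_intros cont\<phi>) auto
  have "\<phi> 0 \<noteq> 0" using Qnz[of 0] by (simp add: \<phi>_def)
  have bound: "norm (L t) \<le> 1 / (1 + b * t\<^sup>2)" if t: "t \<in> {-pi..pi}" for t
  proof -
    have "\<kappa> r * (t\<^sup>2 / 20) \<le> \<kappa> r * (1 - cos t)"
      using t kappa_pos[of r] r by (intro mult_left_mono one_minus_cos_ge) auto
    then have "Q r + \<kappa> r * (t\<^sup>2 / 20) \<le> Re (Q (of_real r * iexp t))"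
      using Re_Q_ge[OF r(1), of t] by linarith
    also have "\<dots> \<le> norm (Q (of_real r * iexp t))" by (rule complex_Re_le_cmod)
    finally have "Q r + \<kappa> r * (t\<^sup>2 / 20) \<le> norm (Q (of_real r * iexp t))" .
    then have le: "Q r * (1 + b * t\<^sup>2) \<le> norm (Q (of_real r * iexp t))"
      using Qr by (simp add: b_def distrib_left)
    define x where "x = norm (of_real (Q r) * \<phi> t)"
    have pos: "1 + b * t\<^sup>2 > 0" using b by (simp add: add_pos_nonneg)
    have "x = Q r / norm (Q (of_real r * iexp t))"
      using Qr by (simp add: x_def \<phi>_def norm_mult norm_inverse divide_inverse)
    also have "\<dots> \<le> Q r / (Q r * (1 + b * t\<^sup>2))"
      using le Qr pos Qnz by (intro divide_left_mono mult_pos_pos) auto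
    finally have x: "x \<le> 1 / (1 + b * t\<^sup>2)" using Qr by simp
    moreover have "1 / (1 + b * t\<^sup>2) \<le> 1" using b pos by (simp add: divide_le_eq_1)
    ultimately have "x \<le> 1" by linarith
    have "norm (L t) = x ^ (p - 1)"
      by (simp add: L_def x_def norm_mult norm_power norm_inverse)
    also have "\<dots> \<le> x ^ 1"
      using \<open>x \<le> 1\<close> p2 by (intro power_decreasing) (auto simp: x_def)
    finally show ?thesis using x by simp
  qed
  have sum_c: "(\<Sum>k=0..d. c k) = 1"
    using Qr by (simp add: c_def Q_def flip: sum_divide_distrib)
  have sum_c\<nu>: "(\<Sum>k=0..d. c k * \<nu> k) = 0"
  proof -
    have "(\<Sum>k=0..d. c k * \<nu> k) = P r / (Q r * real (p - 1))"
      unfolding P_def sum_divide_distrib by (intro sum.cong) (auto simp: c_def \<nu>_def)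
    then show ?thesis by (simp add: root)
  qed
  have \<nu>_eq: "\<nu> k = real (geo k) + 1 / real (p - 1)" for k
    unfolding \<nu>_def power_eq_geo using p2 by (simp add: field_simps)
  \<comment> \<open>\<open>M t = q(s exp(i t / (p - 1))) / q(s)\<close>, whose first derivative at \<open>0\<close> vanishes by \<open>sum_c\<nu>\<close>\<close>
  define M where "M = (\<lambda>t. \<Sum>k=0..d. of_real (c k) * iexp (\<nu> k * t))"
  have M_eq: "M t = iexp (t / real (p - 1)) * Q (of_real r * iexp t) / of_real (Q r)" for t
  proof -
    have "of_real (c k) * iexp (\<nu> k * t) = iexp (t / real (p - 1)) *
        ((-1) ^ k * of_nat (d choose k) * (of_real r * iexp t) ^ geo k) / of_real (Q r)" for k
    proof -
      have "iexp (\<nu> k * t) = iexp (real (geo k) * t) * iexp (t / real (p - 1))"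
        unfolding \<nu>_eq by (simp add: algebra_simps flip: exp_add)
      moreover have "iexp (real (geo k) * t) = iexp t ^ geo k"
        by (simp add: algebra_simps flip: exp_of_nat_mult)
      ultimately show ?thesis
        by (simp add: c_def power_mult_distrib)
    qed
    then show ?thesis
      unfolding M_def Q_def[of "of_real r * iexp t"]
      by (simp only: sum_distrib_left[symmetric] sum_divide_distrib[symmetric])
  qed
  have L_eq: "L t = inverse (M t) ^ (p - 1)" for t
  proof -
    have "iexp (t / real (p - 1)) ^ (p - 1) = iexp t"
      using p2 by (simp flip: exp_of_nat_mult)
    then show ?thesis
      using Qr by (simp add: M_eq L_def \<phi>_def power_mult_distrib power_divide field_simps flip: power_inverse)
  qed
  have lim: "(\<lambda>m. L (u / sqrt m) ^ m) \<longlonglongrightarrow> of_real (exp (- A * u\<^sup>2))" for u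
  proof -
    define S where "S = (\<Sum>k=0..d. of_real (c k) * of_real (- (\<nu> k * u)\<^sup>2 / 2) :: complex)"
    define z where "z = (\<lambda>m::nat. of_nat m * (M (u / sqrt m) - 1))"
    \<comment> \<open>The constant and linear Taylor terms may be inserted because the
      \<open>c k\<close> sum to 1 and the \<open>c k * \<nu> k\<close> to 0; each summand is then a
      second-order remainder.\<close>
    have "z m = (\<Sum>k=0..d. of_real (c k) *
        (of_nat m * (iexp (\<nu> k * u / sqrt m) - 1 - \<i> * of_real (\<nu> k * u / sqrt m))))" for m
    proof -
      have "(\<Sum>k=0..d. of_real (c k) * (of_nat m * (iexp (\<nu> k * u / sqrt m) - 1 - \<i> * of_real (\<nu> k * u / sqrt m)))) =
        of_nat m * (M (u / sqrt m) - of_real (\<Sum>k=0..d. c k) - \<i> * of_real (u / sqrt m) * of_real (\<Sum>k=0..d. c k * \<nu> k))"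
        unfolding M_def of_real_sum sum_distrib_left right_diff_distrib sum_subtractf[symmetric]
        by (intro sum.cong refl) (simp add: algebra_simps)
      then show ?thesis unfolding sum_c sum_c\<nu> by (simp add: z_def)
    qed
    then have "z = (\<lambda>m. \<Sum>k=0..d. of_real (c k) *
        (of_nat m * (iexp (\<nu> k * u / sqrt m) - 1 - \<i> * of_real (\<nu> k * u / sqrt m))))"
      by (rule ext)
    then have "z \<longlonglongrightarrow> S"
      unfolding S_def by (simp only:) (intro tendsto_sum tendsto_mult tendsto_const iexp_second_order_limit)
    then have "(\<lambda>m. (1 + z m / of_nat m) ^ m) \<longlonglongrightarrow> exp S"
      by (rule tendsto_one_plus_over_n_power)
    moreover have "\<forall>\<^sub>F m in sequentially. (1 + z m / of_nat m) ^ m = M (u / sqrt m) ^ m"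
      using eventually_gt_at_top[of 0] by eventually_elim (simp add: z_def)
    ultimately have "(\<lambda>m. M (u / sqrt m) ^ m) \<longlonglongrightarrow> exp S"
      by (rule Lim_transform_eventually)
    then have "(\<lambda>m. inverse (M (u / sqrt m) ^ m) ^ (p - 1)) \<longlonglongrightarrow> inverse (exp S) ^ (p - 1)"
      by (intro tendsto_intros) auto
    also have "(\<lambda>m. inverse (M (u / sqrt m) ^ m) ^ (p - 1)) = (\<lambda>m. L (u / sqrt m) ^ m)"
      unfolding L_eq by (simp add: power_inverse mult.commute flip: power_mult)
    also have "inverse (exp S) ^ (p - 1) = exp (- of_nat (p - 1) * S)"
      by (simp add: exp_minus exp_of_nat_mult power_inverse)
    also have "- of_nat (p - 1) * S = of_real (- A * u\<^sup>2)"
    proof -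
      have "S = of_real (- (\<Sum>k=0..d. c k * (\<nu> k)\<^sup>2 / 2) * u\<^sup>2)"
        unfolding S_def of_real_mult[symmetric] of_real_sum[symmetric] sum_negf[symmetric] sum_distrib_right
        by (intro arg_cong[of _ _ of_real] sum.cong refl) (simp add: power_mult_distrib)
      then show ?thesis by (simp add: A_def)
    qed
    finally show ?thesis by (simp only: exp_of_real)
  qed
  obtain K where K: "K \<noteq> 0" "(\<lambda>m. sqrt m * (LINT t:{-pi..pi}|lborel. \<phi> t * L t ^ m)) \<longlonglongrightarrow> K"
    using laplace_limit[OF contL cont\<phi> pi_gt_zero b \<open>\<phi> 0 \<noteq> 0\<close> bound lim] by blast
  have coeff: "2 * pi * fps_nth (inverse Q_fps ^ (m * (p - 1) + 1)) m =
      of_real (G ^ m) * (LINT t:{-pi..pi}|lborel. \<phi> t * L t ^ m)" for m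
  proof -
    let ?n = "m * (p - 1) + 1"
    have "(\<lambda>w. inverse (Q w) ^ ?n) has_fps_expansion inverse Q_fps ^ ?n"
      by (intro has_fps_expansion_power has_fps_expansion_inverse Q_fps_expansion) (simp add: Q_fps_0)
    moreover have "(\<lambda>w. inverse (Q w) ^ ?n) holomorphic_on ball 0 r\<^sub>0"
      using Q_nonzero by (intro holomorphic_intros Q_holomorphic) auto
    ultimately have "2 * pi * fps_nth (inverse Q_fps ^ ?n) m =
        (LINT t:{-pi..pi}|lborel. inverse (Q (of_real r * iexp t)) ^ ?n / (of_real r * iexp t) ^ m)"
      using r by (rule fps_nth_eq_circle_integral)
    \<comment> \<open>The extra 1 in the exponent \<open>m * (p - 1) + 1\<close> leaves one factor
      \<open>\<phi> t\<close> outside the \<open>m\<close>-th power.\<close>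
    also have "(\<lambda>t. inverse (Q (of_real r * iexp t)) ^ ?n / (of_real r * iexp t) ^ m) =
        (\<lambda>t. of_real (G ^ m) * (\<phi> t * L t ^ m))"
    proof
      fix t
      have "inverse (Q (of_real r * iexp t)) ^ ?n / (of_real r * iexp t) ^ m =
          \<phi> t ^ ?n * inverse ((of_real r * iexp t) ^ m)"
        by (simp add: \<phi>_def divide_inverse)
      also have "\<phi> t ^ ?n = \<phi> t * (\<phi> t ^ (p - 1)) ^ m"
        by (simp only: Suc_eq_plus1[symmetric] power_Suc mult.commute[of m "p - 1"] power_mult)
      also have "\<phi> t * (\<phi> t ^ (p - 1)) ^ m * inverse ((of_real r * iexp t) ^ m) =
          \<phi> t * (\<phi> t ^ (p - 1) * inverse (of_real r * iexp t)) ^ m"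
        by (simp only: power_mult_distrib power_inverse mult.assoc)
      also have "(\<phi> t ^ (p - 1) * inverse (of_real r * iexp t)) ^ m = of_real (G ^ m) * L t ^ m"
        using Qr r by (simp add: L_def G_def power_mult_distrib power_divide field_simps flip: power_mult_distrib)
      finally show "inverse (Q (of_real r * iexp t)) ^ ?n / (of_real r * iexp t) ^ m = of_real (G ^ m) * (\<phi> t * L t ^ m)"
        by (simp only: mult.left_commute)
    qed
    finally show ?thesis by simp
  qed
  have G: "G > 0" using r Qr by (simp add: G_def)
  have "of_real (sqrt m / G ^ m) * fps_nth (inverse Q_fps ^ (m * (p - 1) + 1)) m =
      sqrt m * (LINT t:{-pi..pi}|lborel. \<phi> t * L t ^ m) / of_real (2 * pi)" for m
  proof -
    have "fps_nth (inverse Q_fps ^ (m * (p - 1) + 1)) m =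
       of_real (G ^ m) * (LINT t:{-pi..pi}|lborel. \<phi> t * L t ^ m) / of_real (2 * pi)"
      using coeff[of m] by (simp add: field_simps)
    then show ?thesis using G by (simp add: field_simps)
  qed
  with tendsto_divide[OF K(2) tendsto_const[of "of_real (2 * pi)"]]
  have "(\<lambda>m. of_real (sqrt m / G ^ m) * fps_nth (inverse Q_fps ^ (m * (p - 1) + 1)) m) \<longlonglongrightarrow> K / of_real (2 * pi)"
    by simp
  moreover have "K / of_real (2 * pi) \<noteq> 0" using K(1) by simp
  ultimately show ?thesis using that by blast
qed

section \<open>Transfer to the number of decompositions\<close>

lemma num_decompositions_0: "num_decompositions d p 0 = 0"
  by (simp add: num_decompositions_def decomposition_def)

text \<open>Lagrange inversion applies to \<open>q = X U\<close> with \<open>U\<close> the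
  composition of \<open>Q_fps\<close> with \<open>fps_X ^ (p - 1)\<close>. The coefficient of degree
  \<open>m * (p - 1)\<close> of a series in \<open>fps_X ^ (p - 1)\<close> is the
  \<open>m\<close>-th one of the series in \<open>w\<close>.\<close>

lemma num_decompositions_eq_coefficient:
  "of_nat (m * (p - 1) + 1) * of_nat (num_decompositions d p (m * (p - 1) + 1)) =
    fps_nth (inverse Q_fps ^ (m * (p - 1) + 1)) m"
proof -
  define F :: "complex fps" where "F = Abs_fps (\<lambda>n. of_nat (num_decompositions d p n))"
  define q :: "complex fps" where "q = (\<Sum>k=0..d. fps_const ((-1) ^ k * of_nat (d choose k)) * fps_X ^ (p ^ k))"
  define U where "U = Q_fps oo fps_X ^ (p - 1)"
  let ?n = "m * (p - 1) + 1"
  have F0: "fps_nth F 0 = 0" by (simp add: F_def num_decompositions_0)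
  have X0: "fps_nth (fps_X ^ (p - 1) :: complex fps) 0 = 0" using p2 by simp
  have "fps_const ((-1) ^ k * of_nat c) = ((-1) ^ k * of_nat c :: complex fps)" for k c
    by (cases "even k") (simp_all flip: fps_of_nat)
  moreover have "q oo F = (\<Sum>k=0..d. fps_const ((-1) ^ k * of_nat (d choose k)) * F ^ (p ^ k))"
    unfolding q_def by (simp add: fps_compose_sum_distrib fps_compose_mult_distrib F0 fps_X_power_compose)
  ultimately have "q oo F = fps_X"
    using decompositions_fps_equation unfolding F_def by (simp only:)
  moreover have qU: "q = fps_X * U"
    unfolding q_def U_def Q_fps_def power_eq_geo
    by (simp only: fps_compose_sum_distrib fps_compose_mult_distrib[OF X0] fps_X_power_compose[OF X0]
        fps_const_compose sum_distrib_left power_mult power_Suc mult.left_commute)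
  have "fps_shift 1 q = U" unfolding qU by (simp add: fps_eq_iff)
  have U0: "fps_nth U 0 = 1" by (simp add: U_def Q_fps_0)
  have q0: "fps_nth q 0 = 0" and q1: "fps_nth q 1 = 1"
    unfolding qU using U0 by simp_all
  ultimately have "F oo q = fps_X"
    using F0 fps_compose_inverse_commute by blast
  then have "of_nat ?n * fps_nth F ?n = fps_nth (inverse (fps_shift 1 q) ^ ?n) (?n - 1)"
    using q0 q1 by (intro fps_lagrange_inversion) auto
  also have "inverse (fps_shift 1 q) ^ ?n = (inverse Q_fps ^ ?n) oo fps_X ^ (p - 1)"
    unfolding \<open>fps_shift 1 q = U\<close> U_def
    using fps_inverse_compose[OF X0, of Q_fps] fps_compose_power[OF X0, of "inverse Q_fps"]
    by (simp only: Q_fps_0 one_neq_zero not_False_eq_True True_implies_equals)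
  also have "fps_nth \<dots> (?n - 1) = fps_nth (inverse Q_fps ^ ?n) m"
    using p2 by (simp add: fps_nth_compose_X_power del: power_Suc)
  finally show ?thesis by (simp add: F_def)
qed

lemma q_poly_eq: "q_poly d p z = z * Q (z ^ (p - 1))"
  unfolding q_poly_def Q_def sum_distrib_left power_eq_geo
  by (intro sum.cong refl) (simp add: power_mult mult.left_commute)

lemma deriv_q_poly: "deriv (q_poly d p) z = P (z ^ (p - 1))"
proof (rule DERIV_imp_deriv)
  have "(q_poly d p has_real_derivative
      (\<Sum>k=0..d. (-1) ^ k * real (d choose k) * (real (p ^ k) * z ^ (p ^ k - 1)))) (at z)"
    unfolding q_poly_def[abs_def] by (auto intro!: derivative_eq_intros sum.cong)
  also have "(\<Sum>k=0..d. (-1) ^ k * real (d choose k) * (real (p ^ k) * z ^ (p ^ k - 1))) = P (z ^ (p - 1))"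
    unfolding P_def
  proof (intro sum.cong refl)
    fix k
    have "z ^ (p ^ k - 1) = (z ^ (p - 1)) ^ geo k"
      using power_eq_geo[of k] by (simp flip: power_mult)
    then show "(-1) ^ k * real (d choose k) * (real (p ^ k) * z ^ (p ^ k - 1)) =
        (-1) ^ k * real (d choose k) * real (p ^ k) * (z ^ (p - 1)) ^ geo k"
      by simp
  qed
  finally show "(q_poly d p has_real_derivative P (z ^ (p - 1))) (at z)" .
qed

text \<open>The normalised counts \<open>x m\<close> have a nonzero limit, so consecutive ones have
  ratio tending to 1. The ratios of the factors \<open>sqrt m\<close> and \<open>n m\<close> tend to
  1 too, and only \<open>G\<close> remains.\<close>

lemma decomposition_ratio_tendsto:
  assumes r: "0 < r" "r < r\<^sub>0" and root: "P r = 0"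
  shows "decomposition_ratio d p \<longlonglongrightarrow> 1 / (r * Q r ^ (p - 1))"
proof -
  define G where "G = 1 / (r * Q r ^ (p - 1))"
  have G: "G > 0" using r Q_real_pos[of r] by (simp add: G_def)
  define N where "N = (\<lambda>m. real (num_decompositions d p (m * (p - 1) + 1)))"
  define n where "n = (\<lambda>m. real m * real (p - 1) + 1)"
  have n: "n m > 0" for m by (simp add: n_def add_nonneg_pos)
  define x where "x = (\<lambda>m. sqrt m / G ^ m * (n m * N m))"
  obtain K where K: "K \<noteq> 0"
    "(\<lambda>m. of_real (sqrt m / G ^ m) * fps_nth (inverse Q_fps ^ (m * (p - 1) + 1)) m) \<longlonglongrightarrow> K"
    using coefficient_asymptotics[OF r root] unfolding G_def by blast
  have "of_real (sqrt m / G ^ m) * fps_nth (inverse Q_fps ^ (m * (p - 1) + 1)) m = of_real (x m)" for m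
    unfolding num_decompositions_eq_coefficient[symmetric] by (simp add: x_def N_def n_def)
  then have x: "(\<lambda>m. of_real (x m) :: complex) \<longlonglongrightarrow> K" using K(2) by simp
  then have "(\<lambda>m. of_real (x (Suc m)) / of_real (x m) :: complex) \<longlonglongrightarrow> K / K"
    using K(1) by (intro tendsto_divide LIMSEQ_Suc)
  then have "(\<lambda>m. complex_of_real (x (Suc m) / x m)) \<longlonglongrightarrow> complex_of_real 1" using K(1) by simp
  then have ratio: "(\<lambda>m. x (Suc m) / x m) \<longlonglongrightarrow> 1" by (simp only: tendsto_of_real_iff)
  have "real (p - 1) > 0" using p2 by simp
  then have "(\<lambda>m. n m / n (Suc m)) \<longlonglongrightarrow> 1"
    unfolding n_def by real_asymp
  moreover have "(\<lambda>m. sqrt (real m) / sqrt (real (Suc m))) \<longlonglongrightarrow> 1" by real_asymp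
  ultimately have "(\<lambda>m. x (Suc m) / x m * (G * (sqrt (real m) / sqrt (real (Suc m))) * (n m / n (Suc m)))) \<longlonglongrightarrow> 1 * (G * 1 * 1)"
    by (intro tendsto_mult tendsto_const ratio)
  \<comment> \<open>At \<open>m = 0\<close> the factor \<open>sqrt m\<close> vanishes and cannot be
    cancelled.\<close>
  moreover have "\<forall>\<^sub>F m in sequentially. x (Suc m) / x m * (G * (sqrt (real m) / sqrt (real (Suc m))) * (n m / n (Suc m)))
      = decomposition_ratio d p m"
    using eventually_gt_at_top[of 0]
  proof eventually_elim
    case (elim m)
    have "x (Suc m) / x m * (G * (sqrt (real m) / sqrt (real (Suc m))) * (n m / n (Suc m))) = N (Suc m) / N m"
      using elim G n[of m] n[of "Suc m"] by (simp add: x_def field_simps)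
    also have "\<dots> = decomposition_ratio d p m"
      by (simp add: N_def decomposition_ratio_def)
    finally show ?case .
  qed
  ultimately have "decomposition_ratio d p \<longlonglongrightarrow> 1 * (G * 1 * 1)"
    by (rule Lim_transform_eventually)
  then show ?thesis by (simp add: G_def)
qed

end

theorem corollary11:
  fixes d p :: nat
  assumes "d \<ge> 1" and "p \<ge> 2"
  shows "\<exists>s>0. deriv (q_poly d p) s = 0 \<and> (\<forall>t>0. deriv (q_poly d p) t = 0 \<longrightarrow> s \<le> t) \<and>
           convergent (decomposition_ratio d p) \<and> growth_rate d p = 1 / (q_poly d p s) ^ (p - 1)"
proof -
  interpret positive_splits d p by unfold_locales fact+
  obtain r where r: "0 < r" "r < r\<^sub>0" "P r = 0" and least: "\<And>x. x > 0 \<Longrightarrow> P x = 0 \<Longrightarrow> r \<le> x"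
    using ex_least_root by blast
  \<comment> \<open>The map from \<open>z\<close> to \<open>z ^ (p - 1)\<close> is increasing on the
    positive reals, so by \<open>deriv_q_poly\<close> it matches the least root of \<open>P\<close>
    with the least critical point of \<open>q\<close>.\<close>
  define s where "s = root (p - 1) r"
  have p1: "p - 1 > 0" using assms by simp
  have s: "s > 0" "s ^ (p - 1) = r"
    using r p1 by (simp_all add: s_def)
  have "s \<le> t" if "t > 0" "deriv (q_poly d p) t = 0" for t
  proof -
    have "s ^ (p - 1) \<le> t ^ (p - 1)"
      using least[of "t ^ (p - 1)"] that s by (simp add: deriv_q_poly)
    then show ?thesis using that p1 by (simp add: power_mono_iff s(1) less_imp_le)
  qed
  moreover have "deriv (q_poly d p) s = 0" by (simp only: deriv_q_poly s r)
  moreover have "q_poly d p s ^ (p - 1) = r * Q r ^ (p - 1)"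
    by (simp only: q_poly_eq s power_mult_distrib)
  moreover note decomposition_ratio_tendsto[OF r]
  ultimately show ?thesis
    using s(1) unfolding growth_rate_def convergent_def by (metis limI)
qed

end
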